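(* Let $(\Sigma,\sigma)$ be a mixing shift of finite type with $K\times K$ adjacency matrix $A$, and let $R_A$ be the subring of $K_0(C(H,\alpha))$ generated by $[A,0]$ and $[A,1]$. Then $$\mathrm{Hom}_{R_A}(K_0(S(\Sigma,\sigma,P)),R_A)\cong K_0(U(\Sigma,\sigma,P))$$ as left $R_A$-modules.
   Context: $A$ is a primitive $K\times K$ matrix with non-negative integer entries, $(\Sigma,\sigma)$ the associated edge shift, $P\subset\Sigma$ a finite non-empty $\sigma$-invariant set. $H=H(\Sigma,\sigma)$ is the groupoid $C^*$-algebra of the homoclinic relation ($x_n=y_n$ for all but finitely many $n$), $\alpha(f)(x,y)=f(\sigma^{-1}x,\sigma^{-1}y)$, and $C(H,\alpha)=\{f:\mathbb R\to H\text{ continuous}:f(t+1)=\alpha(f(t))\}$. $S(\Sigma,\sigma,P)$ is the groupoid $C^*$-algebra of the relation "$x_n=y_n$ for all large $n$" on the set of points agreeing with some $p\in P$ for all sufficiently negative $n$; $U(\Sigma,\sigma,P)$ is the same with time reversed. The ring structure on $K_0(C(H,\alpha))$ and the right and left module structures on $K_0(S(\Sigma,\sigma,P))$ and $K_0(U(\Sigma,\sigma,P))$ are induced by the asymptotic morphisms ($t\to+\infty$) $f\otimes g\mapsto\alpha_t(f)\alpha_{-t}(g)$ (with $\alpha_t(f)(s)=f(s+t)$), $c\otimes f\mapsto c\,f(-t)$ and $f\otimes d\mapsto f(t)\,d$. Explicitly, let $C(A)=\{X\in M_K(\mathbb Z):AX=XA\}$. $K_0(C(H,\alpha))$ is the inductive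 limit of $C(A)\to C(A)\to\cdots$ with maps $X\mapsto AXA$; $K_0(S(\Sigma,\sigma,P))$ is the inductive limit of $\mathbb Z^K\to\mathbb Z^K\to\cdots$ (row vectors, $v\mapsto vA$); $K_0(U(\Sigma,\sigma,P))$ is the inductive limit of $\mathbb Z^K\to\mathbb Z^K\to\cdots$ (column vectors, $w\mapsto Aw$). Writing $[\cdot,N]$ for the class of an element of the $N$th group ($N\ge0$), the products are $[X,N]\ast[Y,M]=[XY,N+M]$, $[v,N]\ast[X,M]=[vX,N+2M]$, $[X,M]\ast[w,N]=[Xw,N+2M]$. The elements $[A,0]$ and $[A,1]$ are mutually inverse and central in $K_0(C(H,\alpha))$, so $R_A$ is a commutative unital ring. $\mathrm{Hom}_{R_A}$ denotes $R_A$-module homomorphisms, with $(r\varphi)(s)=r\ast\varphi(s)$ for $r\in R_A$. *)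

theory Defs
  imports "HOL-Analysis.Analysis" "HOL-Algebra.Module" "HOL-Algebra.Generated_Rings"
begin

section \<open>Primitive matrices and edge shifts\<close>

text \<open>The power \<open>A ^ n\<close> of the type \<open>'a ^ 'n ^ 'n\<close> is the componentwise one, hence the
  explicit iteration of the matrix product.\<close>

definition primitive_matrix :: "int ^ 'n ^ 'n \<Rightarrow> bool" where
  "primitive_matrix A \<longleftrightarrow>
     (\<forall>i j. 0 \<le> A $ i $ j) \<and> (\<exists>n\<ge>1. \<forall>i j. 0 < (((**) A ^^ n) (mat 1)) $ i $ j)"

text \<open>The graph of \<open>A\<close> has \<open>A $ i $ j\<close> edges from \<open>i\<close> to \<open>j\<close>, written \<open>(i, j, k)\<close> with
  \<open>k < A $ i $ j\<close>.\<close>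

definition graph_edges :: "int ^ 'n ^ 'n \<Rightarrow> ('n \<times> 'n \<times> nat) set" where
  "graph_edges A = {(i, j, k). int k < A $ i $ j}"

definition edge_shift :: "int ^ 'n ^ 'n \<Rightarrow> (int \<Rightarrow> 'n \<times> 'n \<times> nat) set" where
  "edge_shift A = {x. \<forall>n. x n \<in> graph_edges A \<and> fst (snd (x n)) = fst (x (n + 1))}"

definition shift_map :: "(int \<Rightarrow> 'e) \<Rightarrow> int \<Rightarrow> 'e" where
  "shift_map x = (\<lambda>n. x (n + 1))"

section \<open>Inductive limits\<close>

text \<open>The inductive limit of \<open>G \<rightarrow> G \<rightarrow> \<dots>\<close>, all of whose maps are \<open>T\<close>: pairs \<open>(x, N)\<close>, standing
  for \<open>x\<close> in the \<open>N\<close>th group, are identified when they agree at some later stage.\<close>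

definition lim_rel :: "('a \<Rightarrow> 'a) \<Rightarrow> 'a set \<Rightarrow> (('a \<times> nat) \<times> ('a \<times> nat)) set" where
  "lim_rel T G = {((x, N), (y, M)). x \<in> G \<and> y \<in> G \<and>
     (\<exists>k l. N + k = M + l \<and> (T ^^ k) x = (T ^^ l) y)}"

definition lim_carrier :: "('a \<Rightarrow> 'a) \<Rightarrow> 'a set \<Rightarrow> ('a \<times> nat) set set" where
  "lim_carrier T G = (G \<times> UNIV) // lim_rel T G"

definition lim_class :: "('a \<Rightarrow> 'a) \<Rightarrow> 'a set \<Rightarrow> 'a \<Rightarrow> nat \<Rightarrow> ('a \<times> nat) set" where
  "lim_class T G x N = lim_rel T G `` {(x, N)}"

text \<open>In the two operations below the union is over representatives of the two classes; all the
  sets in it are equal (see \<open>lim_add_class\<close> and \<open>lim_prod_class\<close> below).\<close>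

definition lim_add ::
  "('a::plus \<Rightarrow> 'a) \<Rightarrow> 'a set \<Rightarrow> ('a \<times> nat) set \<Rightarrow> ('a \<times> nat) set \<Rightarrow> ('a \<times> nat) set" where
  "lim_add T G a b =
     (\<Union>(x, N)\<in>a. \<Union>(y, M)\<in>b. lim_class T G ((T ^^ M) x + (T ^^ N) y) (N + M))"

text \<open>The product \<open>[x, N] * [y, M] = [f x y, p * N + q * M]\<close> with values in the limit of \<open>T\<close>.\<close>

definition lim_prod ::
  "('c \<Rightarrow> 'c) \<Rightarrow> 'c set \<Rightarrow> ('a \<Rightarrow> 'b \<Rightarrow> 'c) \<Rightarrow> nat \<Rightarrow> nat \<Rightarrow>
   ('a \<times> nat) set \<Rightarrow> ('b \<times> nat) set \<Rightarrow> ('c \<times> nat) set" where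
  "lim_prod T G f p q a b = (\<Union>(x, N)\<in>a. \<Union>(y, M)\<in>b. lim_class T G (f x y) (p * N + q * M))"

section \<open>The ring K0(C(H, \<alpha>)) and the modules K0(S) and K0(U)\<close>

text \<open>The K-groups are given by their presentations as inductive limits defined by \<open>A\<close>,
  with the products that the asymptotic morphisms induce on them.  The presentations of K0(S) and
  K0(U) do not depend on the finite invariant set \<open>P\<close>.\<close>

definition commutant :: "int ^ 'n ^ 'n \<Rightarrow> (int ^ 'n ^ 'n) set" where
  "commutant A = {X. A ** X = X ** A}"

abbreviation C_map :: "int ^ 'n ^ 'n \<Rightarrow> int ^ 'n ^ 'n \<Rightarrow> int ^ 'n ^ 'n" where
  "C_map A \<equiv> \<lambda>X. A ** X ** A"

abbreviation S_map :: "int ^ 'n ^ 'n \<Rightarrow> int ^ 'n \<Rightarrow> int ^ 'n" where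
  "S_map A \<equiv> \<lambda>v. v v* A"

abbreviation U_map :: "int ^ 'n ^ 'n \<Rightarrow> int ^ 'n \<Rightarrow> int ^ 'n" where
  "U_map A \<equiv> \<lambda>w. A *v w"

abbreviation C_class where "C_class A \<equiv> lim_class (C_map A) (commutant A)"
abbreviation S_class where "S_class A \<equiv> lim_class (S_map A) UNIV"
abbreviation U_class where "U_class A \<equiv> lim_class (U_map A) UNIV"

definition K0_C :: "int ^ 'n ^ 'n \<Rightarrow> ((int ^ 'n ^ 'n) \<times> nat) set ring" where
  "K0_C A =
     \<lparr>carrier = lim_carrier (C_map A) (commutant A),
      mult = lim_prod (C_map A) (commutant A) (**) 1 1,
      one = C_class A (mat 1) 0,
      zero = C_class A 0 0,
      add = lim_add (C_map A) (commutant A)\<rparr>"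

definition R_ring :: "int ^ 'n ^ 'n \<Rightarrow> ((int ^ 'n ^ 'n) \<times> nat) set ring" where
  "R_ring A = (K0_C A)
     \<lparr>carrier := generate_ring (K0_C A) {C_class A A 0, C_class A A 1}\<rparr>"

text \<open>The \<open>mult\<close> and \<open>one\<close> fields of a module record have no meaning.  K0(S) is a right
  module: \<open>r \<odot> s\<close> stands for the product \<open>s * r\<close>, which over the commutative ring \<open>R_ring A\<close> makes
  it a \<open>module\<close> in the sense of the library.\<close>

definition K0_S :: "int ^ 'n ^ 'n \<Rightarrow> (((int ^ 'n ^ 'n) \<times> nat) set, ((int ^ 'n) \<times> nat) set) module" where
  "K0_S A =
     \<lparr>carrier = lim_carrier (S_map A) UNIV, mult = undefined, one = undefined,
      zero = S_class A 0 0, add = lim_add (S_map A) UNIV,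
      smult = (\<lambda>r s. lim_prod (S_map A) UNIV (v*) 1 2 s r)\<rparr>"

definition K0_U :: "int ^ 'n ^ 'n \<Rightarrow> (((int ^ 'n ^ 'n) \<times> nat) set, ((int ^ 'n) \<times> nat) set) module" where
  "K0_U A =
     \<lparr>carrier = lim_carrier (U_map A) UNIV, mult = undefined, one = undefined,
      zero = U_class A 0 0, add = lim_add (U_map A) UNIV,
      smult = lim_prod (U_map A) UNIV (*v) 2 1\<rparr>"

section \<open>Modules of homomorphisms\<close>

definition module_homs :: "('r, 'x) ring_scheme \<Rightarrow> ('r, 'a, 'y) module_scheme \<Rightarrow>
    ('r, 'b, 'z) module_scheme \<Rightarrow> ('a \<Rightarrow> 'b) set" where
  "module_homs R M N = {\<phi> \<in> carrier M \<rightarrow> carrier N.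
     (\<forall>s\<in>carrier M. \<forall>t\<in>carrier M. \<phi> (s \<oplus>\<^bsub>M\<^esub> t) = \<phi> s \<oplus>\<^bsub>N\<^esub> \<phi> t) \<and>
     (\<forall>r\<in>carrier R. \<forall>s\<in>carrier M. \<phi> (r \<odot>\<^bsub>M\<^esub> s) = r \<odot>\<^bsub>N\<^esub> \<phi> s)}"

definition modules_isomorphic :: "('r, 'x) ring_scheme \<Rightarrow> ('r, 'a, 'y) module_scheme \<Rightarrow>
    ('r, 'b, 'z) module_scheme \<Rightarrow> bool" where
  "modules_isomorphic R M N \<longleftrightarrow> (\<exists>\<phi>\<in>module_homs R M N. bij_betw \<phi> (carrier M) (carrier N))"

text \<open>Homomorphisms are taken extensional, so that they are determined by their values on
  \<open>carrier M\<close>.\<close>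

definition Hom_module :: "('r, 'x) ring_scheme \<Rightarrow> ('r, 'a, 'y) module_scheme \<Rightarrow>
    ('r, 'b, 'z) module_scheme \<Rightarrow> ('r, 'a \<Rightarrow> 'b) module" where
  "Hom_module R M N =
     \<lparr>carrier = module_homs R M N \<inter> extensional (carrier M), mult = undefined, one = undefined,
      zero = (\<lambda>s\<in>carrier M. \<zero>\<^bsub>N\<^esub>), add = (\<lambda>\<phi> \<psi>. \<lambda>s\<in>carrier M. \<phi> s \<oplus>\<^bsub>N\<^esub> \<psi> s),
      smult = (\<lambda>r \<phi>. \<lambda>s\<in>carrier M. r \<odot>\<^bsub>N\<^esub> \<phi> s)\<rparr>"

definition regular_module :: "('r, 'x) ring_scheme \<Rightarrow> ('r, 'r) module" where
  "regular_module R =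
     \<lparr>carrier = carrier R, mult = mult R, one = one R, zero = zero R, add = add R,
      smult = mult R\<rparr>"

section \<open>The operations are well defined\<close>

locale lim_system =
  fixes T :: "'a::ab_group_add \<Rightarrow> 'a" and G :: "'a set"
  assumes map_closed: "x \<in> G \<Longrightarrow> T x \<in> G"
    and map_add: "x \<in> G \<Longrightarrow> y \<in> G \<Longrightarrow> T (x + y) = T x + T y"
    and zero_mem: "0 \<in> G"
    and add_mem: "x \<in> G \<Longrightarrow> y \<in> G \<Longrightarrow> x + y \<in> G"
    and uminus_mem: "x \<in> G \<Longrightarrow> - x \<in> G"
begin

lemma funpow_closed: "x \<in> G \<Longrightarrow> (T ^^ n) x \<in> G"
  by (induction n) (auto simp: map_closed)

lemma funpow_map_add: "x \<in> G \<Longrightarrow> y \<in> G \<Longrightarrow> (T ^^ n) (x + y) = (T ^^ n) x + (T ^^ n) y"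
  by (induction n) (auto simp: map_add funpow_closed)

lemma lim_rel_iff:
  "((x, N), (y, M)) \<in> lim_rel T G \<longleftrightarrow>
     x \<in> G \<and> y \<in> G \<and> (\<exists>k l. N + k = M + l \<and> (T ^^ k) x = (T ^^ l) y)"
  by (simp add: lim_rel_def)

lemma equiv_lim_rel: "equiv (G \<times> UNIV) (lim_rel T G)"
proof (rule equivI)
  show "lim_rel T G \<subseteq> (G \<times> UNIV) \<times> (G \<times> UNIV)"
    by (auto simp: lim_rel_def)
  show "refl_on (G \<times> UNIV) (lim_rel T G)"
    by (auto simp: refl_on_def lim_rel_def)
  show "sym (lim_rel T G)"
    by (rule symI) (auto simp: lim_rel_def, metis)
  show "trans (lim_rel T G)"
  proof (rule transI, clarsimp simp: lim_rel_iff)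
    fix x y z :: 'a and N M L k l k' l' :: nat
    assume 1: "N + k = M + l" "(T ^^ k) x = (T ^^ l) y"
      and 2: "M + k' = L + l'" "(T ^^ k') y = (T ^^ l') z"
    have "(T ^^ (k + k')) x = (T ^^ k') ((T ^^ k) x)"
      by (subst add.commute) (simp add: funpow_add)
    also have "\<dots> = (T ^^ (k' + l)) y"
      by (simp add: 1 funpow_add)
    also have "\<dots> = (T ^^ l) ((T ^^ k') y)"
      by (subst add.commute) (simp add: funpow_add)
    also have "\<dots> = (T ^^ (l + l')) z"
      by (simp add: 2 funpow_add)
    finally show "\<exists>k l. N + k = L + l \<and> (T ^^ k) x = (T ^^ l) z"
      using 1 2 by (intro exI[of _ "k + k'"] exI[of _ "l + l'"]) simp
  qed
qed

lemma lim_class_mem: "x \<in> G \<Longrightarrow> (x, N) \<in> lim_class T G x N"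
  unfolding lim_class_def by (rule equiv_class_self[OF equiv_lim_rel]) simp

lemma lim_class_closed: "x \<in> G \<Longrightarrow> lim_class T G x N \<in> lim_carrier T G"
  unfolding lim_class_def lim_carrier_def by (rule quotientI) simp

lemma lim_class_eq_iff:
  assumes "x \<in> G" "y \<in> G"
  shows "lim_class T G x N = lim_class T G y M \<longleftrightarrow>
           (\<exists>k l. N + k = M + l \<and> (T ^^ k) x = (T ^^ l) y)"
  using assms unfolding lim_class_def
  by (subst eq_equiv_class_iff[OF equiv_lim_rel]) (auto simp: lim_rel_iff)

lemma lim_class_funpow: "x \<in> G \<Longrightarrow> lim_class T G ((T ^^ k) x) (k + N) = lim_class T G x N"
  by (subst lim_class_eq_iff) (simp_all add: funpow_closed, rule exI[of _ 0], simp)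

lemma lim_class_map: "x \<in> G \<Longrightarrow> lim_class T G (T x) (Suc N) = lim_class T G x N"
  using lim_class_funpow[of x 1 N] by simp

lemma lim_carrier_cases:
  assumes "a \<in> lim_carrier T G"
  obtains x N where "x \<in> G" "a = lim_class T G x N"
  using assms unfolding lim_carrier_def lim_class_def by (auto elim!: quotientE)

lemma lim_carrier_cases2:
  assumes "a \<in> lim_carrier T G" "b \<in> lim_carrier T G"
  obtains x y N where "x \<in> G" "y \<in> G" "a = lim_class T G x N" "b = lim_class T G y N"
proof -
  obtain x N y M where "x \<in> G" "y \<in> G" "a = lim_class T G x N" "b = lim_class T G y M"
    using assms by (metis lim_carrier_cases)
  then show thesis
    using that[of "(T ^^ M) x" "(T ^^ N) y" "N + M"]
      lim_class_funpow[of x M N] lim_class_funpow[of y N M]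
    by (simp add: funpow_closed add.commute)
qed

lemma lim_carrier_cases3:
  assumes "a \<in> lim_carrier T G" "b \<in> lim_carrier T G" "c \<in> lim_carrier T G"
  obtains x y z N where "x \<in> G" "y \<in> G" "z \<in> G"
    "a = lim_class T G x N" "b = lim_class T G y N" "c = lim_class T G z N"
proof -
  obtain x y N z M where "x \<in> G" "y \<in> G" "z \<in> G"
    "a = lim_class T G x N" "b = lim_class T G y N" "c = lim_class T G z M"
    using assms by (metis lim_carrier_cases lim_carrier_cases2)
  then show thesis
    using that[of "(T ^^ M) x" "(T ^^ M) y" "(T ^^ N) z" "N + M"]
      lim_class_funpow[of x M N] lim_class_funpow[of y M N] lim_class_funpow[of z N M]
    by (simp add: funpow_closed add.commute)
qed

text \<open>A function of representatives that is compatible with passing to the next stage is constant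
  on every class.\<close>

lemma UN_lim_class:
  assumes step: "\<And>y M. y \<in> G \<Longrightarrow> F (T y) (Suc M) = F y M" and x: "x \<in> G"
  shows "(\<Union>(y, M)\<in>lim_class T G x N. F y M) = F x N"
proof -
  have pow: "F ((T ^^ k) y) (M + k) = F y M" if "y \<in> G" for y M k
    by (induction k) (auto simp: step funpow_closed that)
  have "F y M = F x N" if "(y, M) \<in> lim_class T G x N" for y M
    using that pow x unfolding lim_class_def by (clarsimp simp: lim_rel_iff) metis
  then show ?thesis
    using lim_class_mem[OF x] by fast
qed

lemma lim_add_class:
  assumes x: "x \<in> G" and y: "y \<in> G"
  shows "lim_add T G (lim_class T G x N) (lim_class T G y M) =
           lim_class T G ((T ^^ M) x + (T ^^ N) y) (N + M)"
proof -
  have 1: "lim_class T G ((T ^^ M) (T x) + (T ^^ Suc N) y) (Suc N + M) =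
      lim_class T G ((T ^^ M) x + (T ^^ N) y) (N + M)" if "x \<in> G" "y \<in> G" for x y N M
    using lim_class_map[of "(T ^^ M) x + (T ^^ N) y" "N + M"] that
    by (simp add: map_add funpow_closed add_mem funpow_swap1)
  have 2: "lim_class T G ((T ^^ Suc M) x + (T ^^ N) (T y)) (N + Suc M) =
      lim_class T G ((T ^^ M) x + (T ^^ N) y) (N + M)" if "x \<in> G" "y \<in> G" for x y N M
    using 1[of y x N M] that by (simp add: add.commute)
  have "lim_add T G (lim_class T G x N) (lim_class T G y M) =
      (\<Union>(x', N')\<in>lim_class T G x N. lim_class T G ((T ^^ M) x' + (T ^^ N') y) (N' + M))"
    unfolding lim_add_def
  proof (rule SUP_cong[OF refl], clarify)
    fix x' N' assume "(x', N') \<in> lim_class T G x N"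
    then have "x' \<in> G" by (auto simp: lim_class_def lim_rel_def)
    then show "(\<Union>(y', M')\<in>lim_class T G y M. lim_class T G ((T ^^ M') x' + (T ^^ N') y') (N' + M'))
        = lim_class T G ((T ^^ M) x' + (T ^^ N') y) (N' + M)"
      by (intro UN_lim_class y 2)
  qed
  also have "\<dots> = lim_class T G ((T ^^ M) x + (T ^^ N) y) (N + M)"
    by (intro UN_lim_class x 1 y)
  finally show ?thesis .
qed

lemma lim_add_class_same:
  assumes x: "x \<in> G" and y: "y \<in> G"
  shows "lim_add T G (lim_class T G x N) (lim_class T G y N) = lim_class T G (x + y) N"
  using lim_class_funpow[of "x + y" N N]
  by (simp add: lim_add_class assms funpow_map_add add_mem)

lemma lim_class_zero: "lim_class T G 0 N = lim_class T G 0 0"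
proof -
  have "T 0 = 0"
    using map_add[OF zero_mem zero_mem] by simp
  then have "(T ^^ N) 0 = 0"
    by (induction N) auto
  then show ?thesis
    using lim_class_funpow[OF zero_mem, of N 0] by simp
qed

lemma lim_abelian_group:
  assumes "carrier R = lim_carrier T G" "zero R = lim_class T G 0 0" "add R = lim_add T G"
  shows "abelian_group R"
proof (rule abelian_groupI; unfold assms)
  fix a b assume "a \<in> lim_carrier T G" "b \<in> lim_carrier T G"
  then obtain x y N where "x \<in> G" "y \<in> G" "a = lim_class T G x N" "b = lim_class T G y N"
    by (rule lim_carrier_cases2)
  then show "lim_add T G a b \<in> lim_carrier T G" "lim_add T G a b = lim_add T G b a"
    by (simp_all add: lim_add_class_same lim_class_closed add_mem add.commute)
next
  show "lim_class T G 0 0 \<in> lim_carrier T G"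
    by (rule lim_class_closed[OF zero_mem])
next
  fix a b c assume "a \<in> lim_carrier T G" "b \<in> lim_carrier T G" "c \<in> lim_carrier T G"
  then obtain x y z N where "x \<in> G" "y \<in> G" "z \<in> G"
    "a = lim_class T G x N" "b = lim_class T G y N" "c = lim_class T G z N"
    by (rule lim_carrier_cases3)
  then show "lim_add T G (lim_add T G a b) c = lim_add T G a (lim_add T G b c)"
    by (simp add: lim_add_class_same add_mem add.assoc)
next
  fix a assume "a \<in> lim_carrier T G"
  then obtain x N where "x \<in> G" "a = lim_class T G x N"
    by (rule lim_carrier_cases)
  then show "lim_add T G (lim_class T G 0 0) a = a"
    and "\<exists>b\<in>lim_carrier T G. lim_add T G b a = lim_class T G 0 0"
    using lim_class_zero[of N] lim_add_class_same[OF zero_mem, of x N]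
      lim_add_class_same[OF uminus_mem, of x x N] lim_class_closed[OF uminus_mem, of x N]
    by auto
qed

end

locale lim_pairing =
  A: lim_system TA GA + B: lim_system TB GB + C: lim_system TC GC
  for TA :: "'a::ab_group_add \<Rightarrow> 'a" and GA
    and TB :: "'b::ab_group_add \<Rightarrow> 'b" and GB
    and TC :: "'c::ab_group_add \<Rightarrow> 'c" and GC +
  fixes f :: "'a \<Rightarrow> 'b \<Rightarrow> 'c" and p q :: nat
  assumes f_closed: "x \<in> GA \<Longrightarrow> y \<in> GB \<Longrightarrow> f x y \<in> GC"
    and f_left: "x \<in> GA \<Longrightarrow> y \<in> GB \<Longrightarrow> f (TA x) y = (TC ^^ p) (f x y)"
    and f_right: "x \<in> GA \<Longrightarrow> y \<in> GB \<Longrightarrow> f x (TB y) = (TC ^^ q) (f x y)"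
begin

lemma lim_prod_class:
  assumes x: "x \<in> GA" and y: "y \<in> GB"
  shows "lim_prod TC GC f p q (lim_class TA GA x N) (lim_class TB GB y M) =
           lim_class TC GC (f x y) (p * N + q * M)"
proof -
  have 1: "lim_class TC GC (f (TA x) y) (p * Suc N + q * M) =
      lim_class TC GC (f x y) (p * N + q * M)" if "x \<in> GA" "y \<in> GB" for x y N M
    using C.lim_class_funpow[of "f x y" p "p * N + q * M"] that
    by (simp add: f_left f_closed algebra_simps)
  have 2: "lim_class TC GC (f x (TB y)) (p * N + q * Suc M) =
      lim_class TC GC (f x y) (p * N + q * M)" if "x \<in> GA" "y \<in> GB" for x y N M
    using C.lim_class_funpow[of "f x y" q "p * N + q * M"] that
    by (simp add: f_right f_closed algebra_simps)
  have "lim_prod TC GC f p q (lim_class TA GA x N) (lim_class TB GB y M) =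
      (\<Union>(x', N')\<in>lim_class TA GA x N. lim_class TC GC (f x' y) (p * N' + q * M))"
    unfolding lim_prod_def
  proof (rule SUP_cong[OF refl], clarify)
    fix x' N' assume "(x', N') \<in> lim_class TA GA x N"
    then have "x' \<in> GA" by (auto simp: lim_class_def lim_rel_def)
    then show "(\<Union>(y', M')\<in>lim_class TB GB y M. lim_class TC GC (f x' y') (p * N' + q * M'))
        = lim_class TC GC (f x' y) (p * N' + q * M)"
      by (intro B.UN_lim_class y 2)
  qed
  also have "\<dots> = lim_class TC GC (f x y) (p * N + q * M)"
    by (intro A.UN_lim_class x 1 y)
  finally show ?thesis .
qed

end

lemma commutant_mult: "X \<in> commutant A \<Longrightarrow> Y \<in> commutant A \<Longrightarrow> X ** Y \<in> commutant A"
  unfolding commutant_def mem_Collect_eq by (metis matrix_mul_assoc)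

lemma self_mem_commutant: "A \<in> commutant A"
  by (simp add: commutant_def)

lemma one_mem_commutant: "mat 1 \<in> commutant A"
  by (simp add: commutant_def)

lemma mat_mult_uminus:
  "(A :: int ^ 'n ^ 'n) ** (- X) = - (A ** X)" "(- X) ** A = - (X ** A)"
  by (simp_all add: matrix_matrix_mult_def vec_eq_iff sum_negf)

lemma mat_add_rdistrib:
  "(X + Y) ** (A :: int ^ 'n ^ 'n) = X ** A + Y ** A"
  by (simp add: matrix_matrix_mult_def vec_eq_iff sum.distrib distrib_right)

interpretation C: lim_system "C_map A" "commutant A" for A
proof
  show "x \<in> commutant A \<Longrightarrow> C_map A x \<in> commutant A" for x
    by (intro commutant_mult self_mem_commutant)
qed (auto simp: commutant_def matrix_add_ldistrib mat_add_rdistrib mat_mult_uminus)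

interpretation S: lim_system "S_map A" UNIV for A
  by unfold_locales (auto simp: vector_matrix_left_distrib)

interpretation U: lim_system "U_map A" UNIV for A
  by unfold_locales (auto simp: matrix_vector_right_distrib)

interpretation CC: lim_pairing "C_map A" "commutant A" "C_map A" "commutant A"
  "C_map A" "commutant A" "(**)" 1 1 for A
proof
  fix X Y assume "X \<in> commutant A" "Y \<in> commutant A"
  then have c: "X ** A = A ** X" "Y ** A = A ** Y"
    by (simp_all add: commutant_def)
  show "X ** Y \<in> commutant A"
    by (rule commutant_mult) fact+
  show "C_map A X ** Y = (C_map A ^^ 1) (X ** Y)"
    by (simp add: matrix_mul_assoc[symmetric] c(2))
  have "X ** C_map A Y = (X ** A) ** Y ** A"
    by (simp only: matrix_mul_assoc)
  then show "X ** C_map A Y = (C_map A ^^ 1) (X ** Y)"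
    by (simp add: matrix_mul_assoc c(1))
qed

interpretation SC: lim_pairing "S_map A" UNIV "C_map A" "commutant A"
  "S_map A" UNIV "(v*)" 1 2 for A
proof
  fix v X assume "X \<in> commutant A"
  then have c: "A ** X = X ** A"
    by (simp add: commutant_def)
  show "S_map A v v* X = (S_map A ^^ 1) (v v* X)"
    by (simp add: vector_matrix_mul_assoc c)
  show "v v* C_map A X = (S_map A ^^ 2) (v v* X)"
    by (simp add: vector_matrix_mul_assoc c numeral_2_eq_2)
qed simp

interpretation CU: lim_pairing "C_map A" "commutant A" "U_map A" UNIV
  "U_map A" UNIV "(*v)" 2 1 for A
proof
  fix w X assume "X \<in> commutant A"
  then have c: "X ** A = A ** X"
    by (simp add: commutant_def)
  show "X *v U_map A w = (U_map A ^^ 1) (X *v w)"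
    by (simp add: matrix_vector_mul_assoc c)
  show "C_map A X *v w = (U_map A ^^ 2) (X *v w)"
    by (simp add: matrix_vector_mul_assoc matrix_mul_assoc[symmetric] c numeral_2_eq_2)
qed simp

lemma K0_C_mult: "X \<in> commutant A \<Longrightarrow> Y \<in> commutant A \<Longrightarrow>
    C_class A X N \<otimes>\<^bsub>K0_C A\<^esub> C_class A Y M = C_class A (X ** Y) (N + M)"
  using CC.lim_prod_class[of X A Y N M] by (simp add: K0_C_def)

lemma K0_S_smult: "X \<in> commutant A \<Longrightarrow>
    C_class A X M \<odot>\<^bsub>K0_S A\<^esub> S_class A v N = S_class A (v v* X) (N + 2 * M)"
  using SC.lim_prod_class[of v X A N M] by (simp add: K0_S_def)

lemma K0_U_smult: "X \<in> commutant A \<Longrightarrow>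
    C_class A X M \<odot>\<^bsub>K0_U A\<^esub> U_class A w N = U_class A (X *v w) (N + 2 * M)"
  using CU.lim_prod_class[of X A w M N] by (simp add: K0_U_def add.commute)

lemma K0_C_ring: "ring (K0_C A)"
proof (rule ringI)
  show "abelian_group (K0_C A)"
    by (rule C.lim_abelian_group) (simp_all add: K0_C_def)
  note [simp] = C.lim_add_class_same C.lim_class_closed commutant_mult C.add_mem one_mem_commutant
  have eqs: "carrier (K0_C A) = lim_carrier (C_map A) (commutant A)"
    "one (K0_C A) = C_class A (mat 1) 0" "add (K0_C A) = lim_add (C_map A) (commutant A)"
    by (simp_all add: K0_C_def)
  show "Group.monoid (K0_C A)"
  proof (rule monoidI; unfold eqs)
    fix a b assume "a \<in> lim_carrier (C_map A) (commutant A)" "b \<in> lim_carrier (C_map A) (commutant A)"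
    then show "a \<otimes>\<^bsub>K0_C A\<^esub> b \<in> lim_carrier (C_map A) (commutant A)"
      by (auto elim!: C.lim_carrier_cases simp: K0_C_mult)
  next
    fix a b c assume "a \<in> lim_carrier (C_map A) (commutant A)" "b \<in> lim_carrier (C_map A) (commutant A)"
      "c \<in> lim_carrier (C_map A) (commutant A)"
    then show "a \<otimes>\<^bsub>K0_C A\<^esub> b \<otimes>\<^bsub>K0_C A\<^esub> c = a \<otimes>\<^bsub>K0_C A\<^esub> (b \<otimes>\<^bsub>K0_C A\<^esub> c)"
      by (auto elim!: C.lim_carrier_cases simp: K0_C_mult matrix_mul_assoc add.assoc)
  next
    fix a assume "a \<in> lim_carrier (C_map A) (commutant A)"
    then show "C_class A (mat 1) 0 \<otimes>\<^bsub>K0_C A\<^esub> a = a" "a \<otimes>\<^bsub>K0_C A\<^esub> C_class A (mat 1) 0 = a"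
      by (auto elim!: C.lim_carrier_cases simp: K0_C_mult)
  qed simp
  fix a b c assume "a \<in> carrier (K0_C A)" "b \<in> carrier (K0_C A)" "c \<in> carrier (K0_C A)"
  then obtain X Y N Z M where "X \<in> commutant A" "Y \<in> commutant A" "Z \<in> commutant A"
    "a = C_class A X N" "b = C_class A Y N" "c = C_class A Z M"
    unfolding eqs by (metis C.lim_carrier_cases C.lim_carrier_cases2)
  then show "(a \<oplus>\<^bsub>K0_C A\<^esub> b) \<otimes>\<^bsub>K0_C A\<^esub> c = a \<otimes>\<^bsub>K0_C A\<^esub> c \<oplus>\<^bsub>K0_C A\<^esub> b \<otimes>\<^bsub>K0_C A\<^esub> c"
    "c \<otimes>\<^bsub>K0_C A\<^esub> (a \<oplus>\<^bsub>K0_C A\<^esub> b) = c \<otimes>\<^bsub>K0_C A\<^esub> a \<oplus>\<^bsub>K0_C A\<^esub> c \<otimes>\<^bsub>K0_C A\<^esub> b"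
    by (simp_all add: K0_C_mult eqs mat_add_rdistrib matrix_add_ldistrib)
qed

lemma K0_C_inverse:
  "C_class A A 0 \<otimes>\<^bsub>K0_C A\<^esub> C_class A A 1 = \<one>\<^bsub>K0_C A\<^esub>"
  "C_class A A 1 \<otimes>\<^bsub>K0_C A\<^esub> C_class A A 0 = \<one>\<^bsub>K0_C A\<^esub>"
  using C.lim_class_map[OF one_mem_commutant, of A 0]
  by (simp_all add: K0_C_mult self_mem_commutant) (simp_all add: K0_C_def)

lemma R_ring_central:
  assumes "r \<in> carrier (R_ring A)" "a \<in> carrier (K0_C A)"
  shows "r \<otimes>\<^bsub>K0_C A\<^esub> a = a \<otimes>\<^bsub>K0_C A\<^esub> r"
proof -
  interpret K: ring "K0_C A" by (rule K0_C_ring)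
  have gens: "{C_class A A 0, C_class A A 1} \<subseteq> carrier (K0_C A)"
    by (auto simp: K0_C_def C.lim_class_closed self_mem_commutant)
  have "r \<in> generate_ring (K0_C A) {C_class A A 0, C_class A A 1}"
    using assms(1) by (simp add: R_ring_def)
  then show ?thesis
  proof (induction rule: generate_ring.induct)
    case (incl h)
    obtain X N where "X \<in> commutant A" "a = C_class A X N"
      using assms(2) by (auto simp: K0_C_def elim: C.lim_carrier_cases)
    then show ?case
      using incl by (auto simp: K0_C_mult self_mem_commutant add.commute)
        (auto simp: commutant_def)
  next
    case (eng_mult h k)
    then show ?case
      using K.generate_ring_in_carrier[OF gens] assms(2) by (metis K.m_assoc)
  qed (use K.generate_ring_in_carrier[OF gens] assms(2) in
       \<open>auto simp: K.l_minus K.r_minus K.l_distr K.r_distr\<close>)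
qed

lemma R_ring_cring: "cring (R_ring A)" and R_ring_subring: "subring (carrier (R_ring A)) (K0_C A)"
proof -
  interpret K: ring "K0_C A" by (rule K0_C_ring)
  have gens: "{C_class A A 0, C_class A A 1} \<subseteq> carrier (K0_C A)"
    by (auto simp: K0_C_def C.lim_class_closed self_mem_commutant)
  show "subring (carrier (R_ring A)) (K0_C A)"
    using K.generate_ring_is_subring[OF gens] by (simp add: R_ring_def)
  have "ring (R_ring A)"
    using K.generate_ring_is_ring[OF gens] by (simp add: R_ring_def)
  moreover have "Group.comm_monoid (R_ring A)"
  proof (rule monoid.monoid_comm_monoidI)
    show "Group.monoid (R_ring A)"
      using \<open>ring (R_ring A)\<close> by (rule ring.axioms)
    fix a b assume "a \<in> carrier (R_ring A)" "b \<in> carrier (R_ring A)"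
    then show "a \<otimes>\<^bsub>R_ring A\<^esub> b = b \<otimes>\<^bsub>R_ring A\<^esub> a"
      using R_ring_central[of a A b] K.generate_ring_in_carrier[OF gens]
      by (simp add: R_ring_def)
  qed
  ultimately show "cring (R_ring A)"
    by (rule cring.intro)
qed

lemma R_ring_ops:
  "mult (R_ring A) = mult (K0_C A)" "add (R_ring A) = lim_add (C_map A) (commutant A)"
  "one (R_ring A) = C_class A (mat 1) 0"
  by (simp_all add: R_ring_def K0_C_def)

lemma R_ring_carrierD: "r \<in> carrier (R_ring A) \<Longrightarrow> r \<in> lim_carrier (C_map A) (commutant A)"
  using subringE(1)[OF R_ring_subring[of A]] by (auto simp: K0_C_def)

lemma K0_S_module: "module (R_ring A) (K0_S A)"
proof -
  have carrier: "carrier (K0_S A) = lim_carrier (S_map A) UNIV"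
    and add: "add (K0_S A) = lim_add (S_map A) UNIV"
    by (simp_all add: K0_S_def)
  note [simp] = K0_S_smult carrier add R_ring_ops S.lim_add_class_same S.lim_class_closed
    C.lim_add_class_same C.add_mem commutant_mult one_mem_commutant
  have main:
    "r \<odot>\<^bsub>K0_S A\<^esub> a \<in> carrier (K0_S A) \<and>
     (r \<oplus>\<^bsub>R_ring A\<^esub> s) \<odot>\<^bsub>K0_S A\<^esub> a = r \<odot>\<^bsub>K0_S A\<^esub> a \<oplus>\<^bsub>K0_S A\<^esub> s \<odot>\<^bsub>K0_S A\<^esub> a \<and>
     r \<odot>\<^bsub>K0_S A\<^esub> (a \<oplus>\<^bsub>K0_S A\<^esub> b) = r \<odot>\<^bsub>K0_S A\<^esub> a \<oplus>\<^bsub>K0_S A\<^esub> r \<odot>\<^bsub>K0_S A\<^esub> b \<and>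
     (r \<otimes>\<^bsub>R_ring A\<^esub> s) \<odot>\<^bsub>K0_S A\<^esub> a = r \<odot>\<^bsub>K0_S A\<^esub> (s \<odot>\<^bsub>K0_S A\<^esub> a) \<and>
     \<one>\<^bsub>R_ring A\<^esub> \<odot>\<^bsub>K0_S A\<^esub> a = a"
    if *: "r \<in> carrier (R_ring A)" "s \<in> carrier (R_ring A)"
      "a \<in> carrier (K0_S A)" "b \<in> carrier (K0_S A)" for r s a b
  proof -
    obtain v w N where ab: "a = S_class A v N" "b = S_class A w N"
      using *(3,4) unfolding carrier by (metis S.lim_carrier_cases2)
    obtain X Y M where rs: "X \<in> commutant A" "Y \<in> commutant A"
      "r = C_class A X M" "s = C_class A Y M"
      using *(1,2)[THEN R_ring_carrierD] by (metis C.lim_carrier_cases2)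
    have "r \<otimes>\<^bsub>R_ring A\<^esub> s = s \<otimes>\<^bsub>R_ring A\<^esub> r"
      using * by (intro cring.cring_simprules(14)[OF R_ring_cring])
    then have "(r \<otimes>\<^bsub>R_ring A\<^esub> s) \<odot>\<^bsub>K0_S A\<^esub> a = r \<odot>\<^bsub>K0_S A\<^esub> (s \<odot>\<^bsub>K0_S A\<^esub> a)"
      using ab rs by (simp add: K0_C_mult vector_matrix_mul_assoc algebra_simps)
    then show ?thesis
      using ab rs by (simp add: vector_matrix_left_distrib vector_matrix_mult_add_rdistrib)
  qed
  have mem: "\<one>\<^bsub>R_ring A\<^esub> \<in> carrier (R_ring A)" "\<zero>\<^bsub>K0_S A\<^esub> \<in> carrier (K0_S A)"
    using cring.cring_simprules(6)[OF R_ring_cring] by (simp_all add: K0_S_def)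
  show ?thesis
  proof (rule moduleI[OF R_ring_cring])
    show "abelian_group (K0_S A)"
      by (rule S.lim_abelian_group) (simp_all add: K0_S_def)
  qed (use main mem in blast)+
qed

lemma K0_U_module: "module (R_ring A) (K0_U A)"
proof -
  have carrier: "carrier (K0_U A) = lim_carrier (U_map A) UNIV"
    and add: "add (K0_U A) = lim_add (U_map A) UNIV"
    by (simp_all add: K0_U_def)
  note [simp] = K0_U_smult carrier add R_ring_ops U.lim_add_class_same U.lim_class_closed
    C.lim_add_class_same C.add_mem commutant_mult one_mem_commutant
  have main:
    "r \<odot>\<^bsub>K0_U A\<^esub> a \<in> carrier (K0_U A) \<and>
     (r \<oplus>\<^bsub>R_ring A\<^esub> s) \<odot>\<^bsub>K0_U A\<^esub> a = r \<odot>\<^bsub>K0_U A\<^esub> a \<oplus>\<^bsub>K0_U A\<^esub> s \<odot>\<^bsub>K0_U A\<^esub> a \<and>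
     r \<odot>\<^bsub>K0_U A\<^esub> (a \<oplus>\<^bsub>K0_U A\<^esub> b) = r \<odot>\<^bsub>K0_U A\<^esub> a \<oplus>\<^bsub>K0_U A\<^esub> r \<odot>\<^bsub>K0_U A\<^esub> b \<and>
     (r \<otimes>\<^bsub>R_ring A\<^esub> s) \<odot>\<^bsub>K0_U A\<^esub> a = r \<odot>\<^bsub>K0_U A\<^esub> (s \<odot>\<^bsub>K0_U A\<^esub> a) \<and>
     \<one>\<^bsub>R_ring A\<^esub> \<odot>\<^bsub>K0_U A\<^esub> a = a"
    if *: "r \<in> carrier (R_ring A)" "s \<in> carrier (R_ring A)"
      "a \<in> carrier (K0_U A)" "b \<in> carrier (K0_U A)" for r s a b
  proof -
    obtain v w N where ab: "a = U_class A v N" "b = U_class A w N"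
      using *(3,4) unfolding carrier by (metis U.lim_carrier_cases2)
    obtain X Y M where rs: "X \<in> commutant A" "Y \<in> commutant A"
      "r = C_class A X M" "s = C_class A Y M"
      using *(1,2)[THEN R_ring_carrierD] by (metis C.lim_carrier_cases2)
    have "(r \<otimes>\<^bsub>R_ring A\<^esub> s) \<odot>\<^bsub>K0_U A\<^esub> a = r \<odot>\<^bsub>K0_U A\<^esub> (s \<odot>\<^bsub>K0_U A\<^esub> a)"
      using ab rs by (simp add: K0_C_mult matrix_vector_mul_assoc algebra_simps)
    then show ?thesis
      using ab rs by (simp add: matrix_vector_right_distrib matrix_vector_mult_add_rdistrib)
  qed
  have mem: "\<one>\<^bsub>R_ring A\<^esub> \<in> carrier (R_ring A)" "\<zero>\<^bsub>K0_U A\<^esub> \<in> carrier (K0_U A)"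
    using cring.cring_simprules(6)[OF R_ring_cring] by (simp_all add: K0_U_def)
  show ?thesis
  proof (rule moduleI[OF R_ring_cring])
    show "abelian_group (K0_U A)"
      by (rule U.lim_abelian_group) (simp_all add: K0_U_def)
  qed (use main mem in blast)+
qed

lemma regular_module_module:
  assumes "cring R"
  shows "module R (regular_module R)"
proof -
  interpret cring R by fact
  have "\<exists>y\<in>carrier R. y \<oplus>\<^bsub>R\<^esub> x = \<zero>\<^bsub>R\<^esub>" if "x \<in> carrier R" for x
    using that by (intro bexI[of _ "\<ominus>\<^bsub>R\<^esub> x"]) (simp_all add: l_neg)
  then show ?thesis
    by (intro moduleI[OF assms abelian_groupI])
      (auto simp: regular_module_def l_distr r_distr m_assoc a_ac)
qed

end

theory Submission
  imports Defs "HOL-Computational_Algebra.Polynomial_Factorial"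
begin

text \<open>Let \<open>\<int>[A]\<close> be the ring of integer polynomials in \<open>A\<close>, let \<open>M = \<int>\<^sup>K\<close> be the module of row
  vectors and \<open>W = \<int>\<^sup>K\<close> the module of column vectors.  Inverting \<open>A\<close> turns \<open>\<int>[A]\<close>, \<open>M\<close> and \<open>W\<close>
  into \<open>R\<^sub>A\<close>, \<open>K\<^sub>0(S)\<close> and \<open>K\<^sub>0(U)\<close>: the class \<open>[A, 0]\<close> acts as \<open>A\<close>, and passing from stage
  \<open>N\<close> to stage \<open>N + 1\<close> multiplies a class by \<open>A\<^sup>-\<^sup>1\<close> in the two modules but by \<open>A\<^sup>-\<^sup>2\<close> in the ring
  (\<open>R_ring_carrier\<close>, \<open>S_class_shift\<close>, \<open>U_class_shift\<close>, \<open>C_class_shift\<close>).  As \<open>M\<close> is finitely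
  generated, homomorphisms commute with this localisation, so the theorem reduces to
  \<open>Hom\<close> from \<open>M\<close> to \<open>\<int>[A]\<close> over \<open>\<int>[A]\<close> being \<open>W\<close>.

  Clearly \<open>W = Hom(M, \<int>)\<close> over the integers.  The point is that \<open>\<int>[A]\<close>, being generated by a single
  integral element, is isomorphic as a module over itself to its integer dual \<open>Hom(\<int>[A], \<int>)\<close>
  (\<open>order_self_dual\<close>), and that homomorphisms over \<open>\<int>[A]\<close> from \<open>M\<close> to \<open>Hom(\<int>[A], \<int>)\<close> are the same
  as additive maps from \<open>M\<close> to \<open>\<int>\<close>.  Self-duality holds because the minimal
  polynomial of \<open>A\<close> has integer coefficients and leading coefficient 1
  (\<open>monic_minimal_polynomial\<close>, from the Cayley-Hamilton theorem and Gauss's lemma): if its degree is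
  \<open>d + 1\<close>, then \<open>1, A, \<dots>, A\<^sup>d\<close> is a basis of \<open>\<int>[A]\<close>, and with \<open>l\<close> the coefficient
  of \<open>A\<^sup>d\<close> in this basis, the matrix of the form \<open>(X, Y) \<mapsto> l (X ** Y)\<close> is triangular with entries 1
  on the antidiagonal, hence unimodular.

  Spelled out, a column \<open>w\<close> and a row \<open>v\<close> determine \<open>\<Phi> v w \<in> \<int>[A]\<close> by the condition that
  \<open>l (Y ** \<Phi> v w)\<close> is the number \<open>v Y w\<close> for all \<open>Y \<in> \<int>[A]\<close> (\<open>exists_dual_pairing\<close>).  The
  isomorphism from \<open>K\<^sub>0(U)\<close> to the module of homomorphisms sends \<open>[w, M]\<close> to the map
  \<open>[v, N] \<mapsto> A\<^sup>-\<^sup>(\<^sup>N\<^sup>+\<^sup>M\<^sup>) \<Phi> v w\<close> (\<open>dual_isomorphic\<close>).\<close>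

hide_const (open) up_ring.monom up_ring.coeff module.smult

section \<open>Integer polynomials in a matrix\<close>

text \<open>Evaluation by the Horner scheme.  The operator \<open>*\<close> on matrices is the componentwise product, so the
  evaluation \<open>poly\<close> of polynomials over a commutative semiring has the wrong meaning here.\<close>

definition poly_mat :: "int ^ 'n ^ 'n \<Rightarrow> int poly \<Rightarrow> int ^ 'n ^ 'n" where
  "poly_mat A p = fold_coeffs (\<lambda>c X. mat c + A ** X) p 0"

abbreviation mat_pow :: "int ^ 'n ^ 'n \<Rightarrow> nat \<Rightarrow> int ^ 'n ^ 'n" where
  "mat_pow A n \<equiv> poly_mat A (monom 1 n)"

text \<open>The subring \<open>\<int>[A]\<close> of the matrix ring; an order in the sense of algebraic number theory, since it
  is a lattice of finite rank.\<close>

abbreviation matrix_order :: "int ^ 'n ^ 'n \<Rightarrow> (int ^ 'n ^ 'n) set" where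
  "matrix_order A \<equiv> range (poly_mat A)"

lemma mat_add: "mat (a + b) = mat a + (mat b :: int ^ 'n ^ 'n)"
  by (simp add: mat_def vec_eq_iff)

lemma mat_mult_nth: "(mat c ** X) $ i $ j = c * (X :: int ^ 'n ^ 'n) $ i $ j"
  by (simp add: matrix_matrix_mult_def mat_def if_distrib if_distribR cong: if_cong)

lemma mult_mat_nth: "(X ** mat c) $ i $ j = c * (X :: int ^ 'n ^ 'n) $ i $ j"
  by (simp add: matrix_matrix_mult_def mat_def if_distrib if_distribR mult.commute cong: if_cong)

lemma mat_mult_commute: "mat c ** X = X ** mat c" for X :: "int ^ 'n ^ 'n"
  by (simp add: vec_eq_iff mat_mult_nth mult_mat_nth)

lemma mat_mult_mat: "mat (a * b) = mat a ** (mat b :: int ^ 'n ^ 'n)"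
  by (simp add: vec_eq_iff mat_mult_nth) (simp add: mat_def)

lemma poly_mat_0 [simp]: "poly_mat A 0 = 0"
  by (simp add: poly_mat_def)

lemma poly_mat_pCons [simp]: "poly_mat A (pCons c p) = mat c + A ** poly_mat A p"
  by (cases "p = 0 \<and> c = 0") (auto simp: poly_mat_def)

lemma poly_mat_1 [simp]: "poly_mat A 1 = mat 1"
  unfolding one_pCons by simp

lemma poly_mat_add: "poly_mat A (p + q) = poly_mat A p + poly_mat A q"
  by (induction p q rule: poly_induct2) (simp_all add: mat_add matrix_add_ldistrib)

lemma poly_mat_smult: "poly_mat A (smult c p) = mat c ** poly_mat A p"
proof (induction p)
  case (pCons a p)
  have "A ** (mat c ** poly_mat A p) = mat c ** (A ** poly_mat A p)"
    by (simp only: matrix_mul_assoc mat_mult_commute[of c A])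
  with pCons show ?case by (simp add: mat_mult_mat matrix_add_ldistrib)
qed simp

lemma poly_mat_mult: "poly_mat A (p * q) = poly_mat A p ** poly_mat A q"
  by (induction p)
    (simp_all add: poly_mat_add poly_mat_smult mat_add_rdistrib matrix_mul_assoc)

lemma poly_mat_uminus: "poly_mat A (- p) = - poly_mat A p"
  using poly_mat_add[of A p "- p"] by (simp add: eq_neg_iff_add_eq_0 add.commute)

lemma poly_mat_diff: "poly_mat A (p - q) = poly_mat A p - poly_mat A q"
  using poly_mat_add[of A p "- q"] by (simp add: poly_mat_uminus)

lemma mat_pow_Suc: "mat_pow A (Suc n) = A ** mat_pow A n"
  by (simp add: monom_Suc)

lemma mat_pow_add: "mat_pow A (m + n) = mat_pow A m ** mat_pow A n"
  by (simp add: poly_mat_mult[symmetric] mult_monom)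

lemma order_commute:
  "X \<in> matrix_order A \<Longrightarrow> Y \<in> matrix_order A \<Longrightarrow> X ** Y = Y ** X"
  by (auto simp: poly_mat_mult[symmetric] mult.commute)

lemma order_add: "X \<in> matrix_order A \<Longrightarrow> Y \<in> matrix_order A \<Longrightarrow> X + Y \<in> matrix_order A"
  by (auto simp: poly_mat_add[symmetric])

lemma order_uminus: "X \<in> matrix_order A \<Longrightarrow> - X \<in> matrix_order A"
  by (auto simp: poly_mat_uminus[symmetric])

lemma order_mult: "X \<in> matrix_order A \<Longrightarrow> Y \<in> matrix_order A \<Longrightarrow> X ** Y \<in> matrix_order A"
  by (auto simp: poly_mat_mult[symmetric])

lemma order_mat: "mat c \<in> matrix_order A"
  by (rule range_eqI[of _ _ "[:c:]"]) simp

lemma order_self: "A \<in> matrix_order A"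
  by (rule range_eqI[of _ _ "[:0, 1:]"]) simp

lemma order_subset_commutant: "matrix_order A \<subseteq> commutant A"
  using order_commute[OF order_self] by (auto simp: commutant_def)

section \<open>The Cayley-Hamilton theorem\<close>

text \<open>Replacing row \<open>k\<close> of \<open>C\<close> by a unit vector gives the entries of the adjugate matrix, so this is
  the identity of \<open>C\<close> times its adjugate with the scalar matrix of its determinant.  Summing over
  the unit vectors, row \<open>k\<close> becomes row \<open>j\<close>, and for \<open>j \<noteq> k\<close> a row is repeated.\<close>

lemma det_replace_row_sum:
  fixes C :: "'a :: comm_ring_1 ^ 'n ^ 'n"
  shows "(\<Sum>i\<in>UNIV. C $ j $ i * det (\<chi> r. if r = k then axis i 1 else C $ r)) =
           (if j = k then det C else 0)"
proof -
  have row: "C $ j = (\<Sum>i\<in>UNIV. C $ j $ i *s axis i 1)"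
    by (simp add: vec_eq_iff axis_def if_distrib cong: if_cong)
  have "(\<Sum>i\<in>UNIV. C $ j $ i * det (\<chi> r. if r = k then axis i 1 else C $ r)) =
      (\<Sum>i\<in>UNIV. det (\<chi> r. if r = k then C $ j $ i *s axis i 1 else C $ r))"
    by (simp add: det_row_mul)
  also have "\<dots> = det (\<chi> r. if r = k then C $ j else C $ r)"
    by (subst row) (simp only: det_linear_row_sum[OF finite[of UNIV]])
  also have "\<dots> = (if j = k then det C else 0)"
  proof (cases "j = k")
    case True
    then have "(\<chi> r. if r = k then C $ j else C $ r) = C"
      by (simp add: vec_eq_iff)
    with True show ?thesis by simp
  next
    case False
    then show ?thesis
      by (auto intro!: det_identical_rows[of j k] simp: row_def)
  qed
  finally show ?thesis .
qed

definition char_mat :: "int ^ 'n ^ 'n \<Rightarrow> int poly ^ 'n ^ 'n" where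
  "char_mat A = (\<chi> i j. [:- A $ i $ j, if i = j then 1 else 0:])"

text \<open>The factors are allowed to be constants, in which case both sides of the equation are 0.  This
  keeps the formula uniform over all permutations in the Leibniz expansion.\<close>

lemma coeff_prod_linear:
  fixes f :: "'b \<Rightarrow> 'a :: comm_ring_1 poly"
  assumes "finite S" "\<And>i. i \<in> S \<Longrightarrow> degree (f i) \<le> 1"
  shows "degree (prod f S) \<le> card S \<and> coeff (prod f S) (card S) = (\<Prod>i\<in>S. coeff (f i) 1)"
  using assms
proof (induction S rule: finite_induct)
  case (insert x F)
  have "degree (f x * prod f F) \<le> degree (f x) + degree (prod f F)"
    by (rule degree_mult_le)
  moreover have "degree (f x) \<le> 1" "degree (prod f F) \<le> card F"
    using insert by auto
  moreover have "coeff (f x * prod f F) (1 + card F) = coeff (f x) 1 * coeff (prod f F) (card F)"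
  proof -
    obtain a q where f: "f x = pCons a q" by (cases "f x")
    then obtain b where "q = [:b:]"
      using \<open>degree (f x) \<le> 1\<close> by (auto elim: degree_eq_zeroE split: if_splits)
    then show ?thesis
      using f \<open>degree (prod f F) \<le> card F\<close> by (simp add: coeff_eq_0)
  qed
  ultimately have "degree (f x * prod f F) \<le> 1 + card F"
    "coeff (f x * prod f F) (1 + card F) = coeff (f x) 1 * coeff (prod f F) (card F)"
    by linarith+
  then show ?case using insert by simp
qed simp

text \<open>Taking the coefficient of degree \<open>K\<close> in the Leibniz expansion of \<open>det (x I - A)\<close> picks the
  coefficient of \<open>x\<close> from every entry, which gives the expansion of \<open>det I\<close>.\<close>

lemma charpoly_monic:
  fixes A :: "int ^ 'n ^ 'n"
  shows "lead_coeff (det (char_mat A)) = 1"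
proof -
  let ?C = "char_mat A" and ?P = "{p. p permutes (UNIV :: 'n set)}"
  have prods: "degree (\<Prod>i\<in>UNIV. ?C $ i $ p i) \<le> CARD('n)"
    "coeff (\<Prod>i\<in>UNIV. ?C $ i $ p i) CARD('n) = (\<Prod>i\<in>UNIV. mat 1 $ i $ p i)" for p
  proof -
    have deg: "degree (?C $ i $ p i) \<le> 1" and lin: "coeff (?C $ i $ p i) 1 = mat 1 $ i $ p i" for i
      by (simp_all add: char_mat_def mat_def)
    show "degree (\<Prod>i\<in>UNIV. ?C $ i $ p i) \<le> CARD('n)"
      "coeff (\<Prod>i\<in>UNIV. ?C $ i $ p i) CARD('n) = (\<Prod>i\<in>UNIV. mat 1 $ i $ p i)"
      using coeff_prod_linear[of UNIV "\<lambda>i. ?C $ i $ p i", OF finite deg] by (simp_all only: lin)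
  qed
  have "degree (det ?C) \<le> CARD('n)"
    unfolding det_def
    by (intro degree_sum_le) (auto simp: sign_def prods)
  moreover have "coeff (det ?C) CARD('n) = det (mat 1 :: int ^ 'n ^ 'n)"
    unfolding det_def coeff_sum by (intro sum.cong) (auto simp: sign_def prods)
  ultimately show ?thesis
    by (metis det_I le_antisym le_degree zero_neq_one)
qed

text \<open>Let \<open>x\<close> act on column vectors as \<open>A\<close>.  The columns of \<open>x I - A\<close> express relations between the
  unit vectors; multiplying these relations by the adjugate shows that \<open>det (x I - A)\<close> kills
  every unit vector.\<close>

theorem Cayley_Hamilton:
  fixes A :: "int ^ 'n ^ 'n"
  shows "poly_mat A (det (char_mat A)) = 0"
proof -
  define act where "act p v = poly_mat A p *v v" for p and v :: "int ^ 'n"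
  have act_mult: "act (p * q) v = act p (act q v)" for p q v
    by (simp add: act_def poly_mat_mult matrix_vector_mul_assoc)
  have act_sum: "act (sum f S) v = (\<Sum>i\<in>S. act (f i) v)" if "finite S" for f :: "'n \<Rightarrow> _" and S v
    using that by induction (simp_all add: act_def poly_mat_add matrix_vector_mult_add_rdistrib)
  have act_sum': "act p (sum f S) = (\<Sum>i\<in>S. act p (f i))" if "finite S" for f :: "'n \<Rightarrow> _" and S p
    using that by induction (simp_all add: act_def matrix_vector_right_distrib)
  let ?C = "char_mat A"
  define adj where "adj k i = det (\<chi> r. if r = k then axis i 1 else ?C $ r)" for k i
  have coord: "(X *v axis k 1) $ l = X $ l $ k" for X :: "int ^ 'n ^ 'n" and l k
    by (simp add: matrix_vector_mult_def axis_def if_distrib cong: if_cong)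
  have rel: "(\<Sum>j\<in>UNIV. act (?C $ j $ i) (axis j 1)) = 0" for i
  proof -
    have "act (?C $ j $ i) (axis j 1) $ l = A $ l $ j * mat 1 $ j $ i - A $ j $ i * mat 1 $ l $ j" for j l
      by (simp add: act_def coord char_mat_def mult_mat_nth mat_mult_commute[symmetric] mat_mult_nth) (simp add: mat_def)
    then have "(\<Sum>j\<in>UNIV. act (?C $ j $ i) (axis j 1)) $ l = (A ** mat 1 - mat 1 ** A) $ l $ i" for l
      by (simp only: sum_component sum_subtractf matrix_matrix_mult_def vector_minus_component
            vec_lambda_beta mult.commute[of "mat 1 $ l $ _"])
    then show ?thesis
      by (simp add: vec_eq_iff)
  qed
  have "act (det ?C) (axis k 1) = 0" for k
  proof -
    have "act (det ?C) (axis k 1) = (\<Sum>j\<in>UNIV. act (\<Sum>i\<in>UNIV. ?C $ j $ i * adj k i) (axis j 1))"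
      unfolding adj_def det_replace_row_sum
      by (subst sum.remove[of _ k]) (auto simp: act_def intro!: sum.neutral)
    also have "\<dots> = (\<Sum>i\<in>UNIV. act (adj k i) (\<Sum>j\<in>UNIV. act (?C $ j $ i) (axis j 1)))"
      by (simp add: act_sum act_sum' mult.commute[of "?C $ _ $ _"] act_mult) (rule sum.swap)
    also have "\<dots> = 0" by (simp only: rel) (simp add: act_def)
    finally show ?thesis .
  qed
  then show ?thesis
    by (simp add: vec_eq_iff act_def flip: coord)
qed

section \<open>The minimal polynomial\<close>

lemma mat_mult_eq_0: "c \<noteq> 0 \<Longrightarrow> mat c ** X = 0 \<Longrightarrow> X = (0 :: int ^ 'n ^ 'n)"
  by (auto simp: vec_eq_iff mat_mult_nth)

text \<open>Let \<open>h\<close> be a primitive annihilating polynomial of least degree.  Pseudo-division of the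
  characteristic polynomial \<open>f\<close> by \<open>h\<close> leaves no remainder, so \<open>c f = h q\<close> with an integer \<open>c\<close>.  By
  Gauss's lemma \<open>c\<close> divides \<open>q\<close>, and then the leading coefficient of \<open>h\<close> divides that of
  \<open>f\<close>, which is 1.\<close>

lemma monic_minimal_polynomial:
  fixes A :: "int ^ 'n ^ 'n"
  obtains m where "lead_coeff m = 1" "poly_mat A m = 0" "degree m > 0"
    "\<And>p. poly_mat A p = 0 \<Longrightarrow> degree p < degree m \<Longrightarrow> p = 0"
proof -
  let ?ann = "\<lambda>p. p \<noteq> 0 \<and> poly_mat A p = 0"
  define f where "f = det (char_mat A)"
  have f: "lead_coeff f = 1" "poly_mat A f = 0"
    unfolding f_def by (rule charpoly_monic, rule Cayley_Hamilton)
  have "?ann f" using f by auto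
  then obtain g where g: "?ann g" and g_min: "\<And>p. ?ann p \<Longrightarrow> degree g \<le> degree p"
    using ex_has_least_nat[of ?ann f degree] by blast
  define h where "h = primitive_part g"
  have h0: "h \<noteq> 0" "degree h = degree g" "content h = 1"
    using g by (auto simp: h_def)
  have "mat (content g) ** poly_mat A h = 0"
    using g by (simp add: h_def poly_mat_smult[symmetric])
  then have h: "poly_mat A h = 0"
    using mat_mult_eq_0[of "content g"] g by auto
  have h_min: "p = 0" if "poly_mat A p = 0" "degree p < degree h" for p
    using g_min[of p] that h0 by fastforce
  obtain q r where qr: "pseudo_divmod f h = (q, r)" by (cases "pseudo_divmod f h")
  define c where "c = lead_coeff h ^ (Suc (degree f) - degree h)"
  have c: "c \<noteq> 0" using h0(1) by (simp add: c_def)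
  have div: "smult c f = h * q + r" "r = 0 \<or> degree r < degree h"
    using pseudo_divmod[OF h0(1) qr] by (simp_all add: c_def)
  have "poly_mat A (h * q + r) = 0"
    unfolding div(1)[symmetric] by (simp add: poly_mat_smult f)
  then have "poly_mat A r = 0" by (simp add: poly_mat_add poly_mat_mult h)
  then have "r = 0" using div(2) h_min by blast
  with div have div: "smult c f = h * q" by simp
  have "content f dvd 1"
    using content_dvd_coeff[of f "degree f"] f by simp
  then have "content f = 1" by (simp only: is_unit_content_iff)
  then have "content q = normalize c"
    using arg_cong[OF div, of content] h0 by (simp add: content_mult)
  then obtain q' where q': "q = smult c q'"
    using const_poly_dvd_iff_dvd_content[of c q] by (auto elim!: dvdE)
  have "smult c f = smult c (h * q')" using div q' by simp
  then have "smult c (f - h * q') = 0" by (simp add: smult_diff_right)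
  then have "f = h * q'" using c by simp
  then have "lead_coeff h * lead_coeff q' = 1" using f by (simp add: lead_coeff_mult)
  then have unit: "lead_coeff h = 1 \<or> lead_coeff h = -1"
    using zmult_eq_1_iff by blast
  \<comment> \<open>The leading coefficient of \<open>h\<close> is a sign, which is removed.\<close>
  define m where "m = smult (lead_coeff h) h"
  show thesis
  proof
    show "lead_coeff m = 1" using unit by (auto simp: m_def)
    show "poly_mat A m = 0" by (simp add: m_def poly_mat_smult h)
    have dm: "degree m = degree h" using h0(1) by (simp add: m_def)
    then show "p = 0" if "poly_mat A p = 0" "degree p < degree m" for p
      using h_min that by simp
    show "degree m > 0"
    proof (rule ccontr)
      assume "\<not> ?thesis"
      then have "m = 1" using \<open>lead_coeff m = 1\<close>
        by (auto elim!: degree_eq_zeroE simp: one_pCons)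
      then have "(mat 1 :: int ^ 'n ^ 'n) = 0" using \<open>poly_mat A m = 0\<close> by simp
      then have "(mat 1 :: int ^ 'n ^ 'n) $ i $ i = 0" for i by simp
      then show False by (simp add: mat_def)
    qed
  qed
qed

section \<open>Duality over the ring of polynomials in a matrix\<close>

text \<open>The functional \<open>l\<close> is the top coefficient with respect to the basis of powers of \<open>A\<close>.  The last
  two properties together say that \<open>X \<mapsto> (Y \<mapsto> l (Y ** X))\<close> is an isomorphism from \<open>\<int>[A]\<close> to its
  integer dual.  Injectivity: multiplying \<open>X \<noteq> 0\<close> by a suitable power of \<open>A\<close> moves its leading
  coefficient to the top.  Surjectivity: a triangular system of equations is solved for the
  coefficients of \<open>X\<close>, beginning with the highest one.\<close>

lemma order_self_dual:
  fixes A :: "int ^ 'n ^ 'n"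
  obtains l :: "int ^ 'n ^ 'n \<Rightarrow> int" where
    "\<And>X Y. X \<in> matrix_order A \<Longrightarrow> Y \<in> matrix_order A \<Longrightarrow> l (X + Y) = l X + l Y"
    "\<And>c X. X \<in> matrix_order A \<Longrightarrow> l (mat c ** X) = c * l X"
    "\<And>X. X \<in> matrix_order A \<Longrightarrow> (\<And>Y. Y \<in> matrix_order A \<Longrightarrow> l (Y ** X) = 0) \<Longrightarrow> X = 0"
    "\<And>f :: int ^ 'n ^ 'n \<Rightarrow> int. (\<And>X Y. X \<in> matrix_order A \<Longrightarrow> Y \<in> matrix_order A \<Longrightarrow> f (X + Y) = f X + f Y) \<Longrightarrow>
       (\<And>c X. X \<in> matrix_order A \<Longrightarrow> f (mat c ** X) = c * f X) \<Longrightarrow>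
       \<exists>X\<in>matrix_order A. \<forall>Y\<in>matrix_order A. l (Y ** X) = f Y"
proof -
  obtain m where m: "lead_coeff m = 1" "poly_mat A m = 0" "degree m > 0"
    and m_min: "\<And>p. poly_mat A p = 0 \<Longrightarrow> degree p < degree m \<Longrightarrow> p = 0"
    by (rule monic_minimal_polynomial) blast
  define d where "d = degree m - 1"
  have d: "degree m = Suc d" using m by (simp add: d_def)
  have inj: "p = q" if "poly_mat A p = poly_mat A q" "degree p \<le> d" "degree q \<le> d" for p q
    using m_min[of "p - q"] that degree_diff_le[of p d q] d by (simp add: poly_mat_diff)
  have ex: "\<exists>p. X = poly_mat A p \<and> degree p \<le> d" if X: "X \<in> matrix_order A" for X
  proof -
    obtain f where f: "X = poly_mat A f" using X by blast
    obtain q r where qr: "pseudo_divmod f m = (q, r)" by (cases "pseudo_divmod f m")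
    have "m \<noteq> 0" using m(3) by auto
    then have "f = m * q + r" "r = 0 \<or> degree r < degree m"
      using pseudo_divmod[OF _ qr] m(1) by simp_all
    then have "X = poly_mat A r" "degree r \<le> d"
      using m d by (auto simp: f poly_mat_add poly_mat_mult)
    then show ?thesis by blast
  qed
  define rep where "rep X = (THE p. X = poly_mat A p \<and> degree p \<le> d)" for X
  have rep_eq: "rep (poly_mat A p) = p" if "degree p \<le> d" for p
    unfolding rep_def using that inj by (intro the_equality) auto
  define l where "l X = coeff (rep X) d" for X
  have l: "l (poly_mat A p) = coeff p d" if "degree p \<le> d" for p
    using that by (simp add: l_def rep_eq)
  have l_add: "l (X + Y) = l X + l Y" if XY: "X \<in> matrix_order A" "Y \<in> matrix_order A" for X Y
  proof -
    obtain p q where "X = poly_mat A p" "degree p \<le> d" "Y = poly_mat A q" "degree q \<le> d"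
      using XY[THEN ex] by blast
    then show ?thesis by (simp add: l degree_add_le flip: poly_mat_add)
  qed
  have l_mat: "l (mat c ** X) = c * l X" if X: "X \<in> matrix_order A" for c X
  proof -
    obtain p where p: "X = poly_mat A p" "degree p \<le> d"
      using ex[OF X] by blast
    have "degree (smult c p) \<le> d" using p degree_smult_le[of c p] by linarith
    with p show ?thesis by (simp add: l flip: poly_mat_smult)
  qed
  have l_pow: "l (mat_pow A i) = (if i = d then 1 else 0)" if "i \<le> d" for i
    using that degree_monom_le[of "1::int" i] by (simp add: l degree_monom_eq)
  show thesis
  proof (rule that[of l])
    fix X assume X: "X \<in> matrix_order A" and ann: "\<And>Y. Y \<in> matrix_order A \<Longrightarrow> l (Y ** X) = 0"
    obtain p where p: "X = poly_mat A p" "degree p \<le> d" using ex[OF X] by blast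
    show "X = 0"
    proof (rule ccontr)
      assume "X \<noteq> 0"
      then have "p \<noteq> 0" using p by auto
      let ?q = "monom 1 (d - degree p) * p"
      have "degree ?q = d"
        using p(2) \<open>p \<noteq> 0\<close> by (simp add: degree_mult_eq degree_monom_eq)
      then have "l (mat_pow A (d - degree p) ** X) = lead_coeff ?q"
        using l[of ?q] by (simp add: p(1) poly_mat_mult)
      also have "\<dots> \<noteq> 0" using \<open>p \<noteq> 0\<close> by simp
      finally show False using ann by simp
    qed
  next
    fix f :: "int ^ 'n ^ 'n \<Rightarrow> int"
    assume f_add: "\<And>X Y. X \<in> matrix_order A \<Longrightarrow> Y \<in> matrix_order A \<Longrightarrow> f (X + Y) = f X + f Y"
      and f_mat: "\<And>c X. X \<in> matrix_order A \<Longrightarrow> f (mat c ** X) = c * f X"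
    \<comment> \<open>Adding a multiple of \<open>A\<^sup>d\<^sup>-\<^sup>n\<close> corrects the value at \<open>A\<^sup>n\<close> and keeps those at lower powers.\<close>
    have "\<exists>X\<in>matrix_order A. \<forall>i<n. l (mat_pow A i ** X) = f (mat_pow A i)" if "n \<le> Suc d" for n
      using that
    proof (induction n)
      case 0
      then show ?case using order_self by auto
    next
      case (Suc n)
      then obtain X where X: "X \<in> matrix_order A"
        and eq: "\<forall>i<n. l (mat_pow A i ** X) = f (mat_pow A i)" by auto
      define c where "c = f (mat_pow A n) - l (mat_pow A n ** X)"
      define Z where "Z = mat c ** mat_pow A (d - n)"
      have Z: "Z \<in> matrix_order A" by (auto simp: Z_def intro!: order_mult order_mat)
      have lZ: "l (mat_pow A i ** Z) = (if i = n then c else 0)" if "i \<le> n" for i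
      proof -
        have "mat_pow A i ** Z = mat c ** (mat_pow A i ** mat_pow A (d - n))"
          unfolding Z_def by (simp only: matrix_mul_assoc mat_mult_commute[of c "mat_pow A i"])
        then have "l (mat_pow A i ** Z) = c * l (mat_pow A (i + (d - n)))"
          by (simp add: l_mat mat_pow_add order_mult)
        also have "\<dots> = (if i = n then c else 0)"
          using Suc.prems that by (subst l_pow) auto
        finally show ?thesis .
      qed
      have "l (mat_pow A i ** (X + Z)) = f (mat_pow A i)" if "i < Suc n" for i
      proof -
        have "l (mat_pow A i ** (X + Z)) = l (mat_pow A i ** X) + l (mat_pow A i ** Z)"
          using X Z by (simp add: matrix_add_ldistrib l_add order_mult)
        also have "\<dots> = f (mat_pow A i)"
          using that eq by (simp add: lZ) (auto simp: c_def less_Suc_eq)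
        finally show ?thesis .
      qed
      moreover have "X + Z \<in> matrix_order A" using X Z by (rule order_add)
      ultimately show ?case by blast
    qed
    then obtain X where X: "X \<in> matrix_order A"
      and eq: "\<And>i. i \<le> d \<Longrightarrow> l (mat_pow A i ** X) = f (mat_pow A i)"
      by (metis le_imp_less_Suc order_refl)
    \<comment> \<open>Agreement on the basis of powers extends to all of \<open>\<int>[A]\<close> by additivity.\<close>
    have "l (poly_mat A p ** X) = f (poly_mat A p)" if "degree p < n" "n \<le> Suc d" for n p
      using that
    proof (induction n arbitrary: p)
      case (Suc n)
      let ?c = "coeff p n" 
      let ?q = "p - monom ?c n"
      have pw: "poly_mat A (monom ?c n) = mat ?c ** mat_pow A n"
        by (simp add: smult_monom flip: poly_mat_smult)
      have top: "l (poly_mat A (monom ?c n) ** X) = f (poly_mat A (monom ?c n))"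
        using Suc.prems X by (simp only: pw matrix_mul_assoc[symmetric] l_mat f_mat eq order_mult rangeI)
      have "l (poly_mat A ?q ** X) = f (poly_mat A ?q)"
      proof (cases "n = 0")
        case True
        then have "?q = 0" using Suc.prems by (auto elim!: degree_eq_zeroE simp: monom_0)
        then show ?thesis
          using l_add[of 0 0] f_add[of 0 0] order_mat[of 0 A] by simp
      next
        case False
        have "coeff ?q i = 0" if "i \<ge> n" for i
          using that Suc.prems by (cases "i = n") (auto simp: coeff_eq_0)
        then have "degree ?q < n" using False by (metis degree_0 leading_coeff_0_iff not_le bot_nat_0.not_eq_extremum)
        with Suc show ?thesis by simp
      qed
      then have "l (poly_mat A (?q + monom ?c n) ** X) = f (poly_mat A (?q + monom ?c n))"
        using X top by (simp only: poly_mat_add mat_add_rdistrib l_add f_add order_mult rangeI)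
      then show ?case by simp
    qed simp
    then have "\<forall>Y\<in>matrix_order A. l (Y ** X) = f Y"
      using ex by (metis le_imp_less_Suc order_refl)
    with X show "\<exists>X\<in>matrix_order A. \<forall>Y\<in>matrix_order A. l (Y ** X) = f Y" by blast
  qed (fact l_add l_mat)+
qed

definition dot :: "int ^ 'n \<Rightarrow> int ^ 'n \<Rightarrow> int" where
  "dot v w = (\<Sum>i\<in>UNIV. v $ i * w $ i)"

lemma dot_add: "dot (v + v') w = dot v w + dot v' w" "dot v (w + w') = dot v w + dot v w'"
  by (simp_all add: dot_def algebra_simps sum.distrib)

lemma dot_adjoint: "dot (v v* X) w = dot v (X *v w)"
  unfolding dot_def vector_matrix_mult_def matrix_vector_mult_def
  by (simp add: sum_distrib_left sum_distrib_right) (subst sum.swap, simp add: mult_ac)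

lemma dot_mat: "dot v (mat c *v w) = c * dot v w"
  by (simp add: dot_def matrix_vector_mult_def mat_def if_distrib if_distribR sum_distrib_left mult_ac cong: if_cong)

lemma dot_axis: "dot (axis i 1) w = w $ i"
  by (simp add: dot_def axis_def if_distrib if_distribR cong: if_cong)

text \<open>The unit vectors generate \<open>\<int>\<^sup>K\<close> as a group, so additive maps may be compared on them.\<close>

lemma int_vec_induct:
  fixes v :: "int ^ 'n"
  assumes axis: "\<And>i. Q (axis i 1)" and diff: "\<And>v w. Q v \<Longrightarrow> Q w \<Longrightarrow> Q (v - w)"
  shows "Q v"
proof -
  have zero: "Q 0" using diff[OF axis axis, of undefined undefined] by simp
  have minus: "Q (- v)" if "Q v" for v using diff[OF zero that] by simp
  have add: "Q (v + w)" if "Q v" "Q w" for v w using diff[OF that(1) minus[OF that(2)]] by simp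
  have pos: "Q (int n *s axis i 1)" for n i
    by (induction n) (auto simp: zero vector_sadd_rdistrib intro!: add axis)
  have scaled: "Q (c *s axis i 1)" for c i
  proof (cases c rule: int_cases2)
    case (nonpos n)
    then have "c *s axis i 1 = - (int n *s axis i 1)" by (simp add: vec_eq_iff)
    then show ?thesis using minus[OF pos] by simp
  qed (simp add: pos)
  have "Q (\<Sum>i\<in>S. v $ i *s axis i 1)" if "finite S" for S
    using that by induction (auto intro: zero add scaled)
  moreover have "(\<Sum>i\<in>UNIV. v $ i *s axis i 1) = v"
    by (simp add: vec_eq_iff axis_def if_distrib cong: if_cong)
  ultimately show ?thesis by (metis finite)
qed

text \<open>The functional \<open>Y \<mapsto> v Y w\<close> on \<open>\<int>[A]\<close> has the form \<open>Y \<mapsto> l (Y ** X)\<close> for a unique \<open>X\<close>, which is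
  taken for \<open>\<Phi> v w\<close>; its algebraic properties follow from uniqueness.  The last one says that every
  homomorphism \<open>\<psi>\<close> from row vectors to \<open>\<int>[A]\<close> arises from a column \<open>w\<close>: the additive map \<open>l \<circ> \<psi>\<close> is
  the product with some \<open>w\<close>, and by linearity \<open>l (Y ** \<psi> v) = l (\<psi> (v Y)) = v Y w\<close>.\<close>

lemma exists_dual_pairing:
  fixes A :: "int ^ 'n ^ 'n"
  obtains \<Phi> :: "int ^ 'n \<Rightarrow> int ^ 'n \<Rightarrow> int ^ 'n ^ 'n" where
    "\<And>v w. \<Phi> v w \<in> matrix_order A"
    "\<And>v v' w. \<Phi> (v + v') w = \<Phi> v w + \<Phi> v' w"
    "\<And>v w w'. \<Phi> v (w + w') = \<Phi> v w + \<Phi> v w'"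
    "\<And>v w X. X \<in> matrix_order A \<Longrightarrow> \<Phi> (v v* X) w = X ** \<Phi> v w"
    "\<And>v w X. X \<in> matrix_order A \<Longrightarrow> \<Phi> v (X *v w) = X ** \<Phi> v w"
    "\<And>w w'. (\<And>i. \<Phi> (axis i 1) w = \<Phi> (axis i 1) w') \<Longrightarrow> w = w'"
    "\<And>\<psi>. (\<And>v. \<psi> v \<in> matrix_order A) \<Longrightarrow> (\<And>v v'. \<psi> (v + v') = \<psi> v + \<psi> v') \<Longrightarrow>
       (\<And>v. \<psi> (v v* A) = A ** \<psi> v) \<Longrightarrow> \<exists>w. \<forall>v. \<psi> v = \<Phi> v w"
proof -
  let ?R = "matrix_order A"
  obtain l :: "int ^ 'n ^ 'n \<Rightarrow> int" where
    l_add: "\<And>X Y. X \<in> ?R \<Longrightarrow> Y \<in> ?R \<Longrightarrow> l (X + Y) = l X + l Y"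
    and l_mat: "\<And>c X. X \<in> ?R \<Longrightarrow> l (mat c ** X) = c * l X"
    and nondeg: "\<And>X. X \<in> ?R \<Longrightarrow> (\<And>Y. Y \<in> ?R \<Longrightarrow> l (Y ** X) = 0) \<Longrightarrow> X = 0"
    and rep: "\<And>f :: int ^ 'n ^ 'n \<Rightarrow> int. (\<And>X Y. X \<in> ?R \<Longrightarrow> Y \<in> ?R \<Longrightarrow> f (X + Y) = f X + f Y) \<Longrightarrow>
       (\<And>c X. X \<in> ?R \<Longrightarrow> f (mat c ** X) = c * f X) \<Longrightarrow> \<exists>X\<in>?R. \<forall>Y\<in>?R. l (Y ** X) = f Y"
    by (rule order_self_dual[of A]) blast
  have unique: "X = X'" if X: "X \<in> ?R" "X' \<in> ?R" and eq: "\<And>Y. Y \<in> ?R \<Longrightarrow> l (Y ** X) = l (Y ** X')" for X X'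
  proof -
    have "l (Y ** (X + - X')) = 0" if "Y \<in> ?R" for Y
    proof -
      have "l (Y ** X) = l (Y ** (X + - X') + Y ** X')"
        by (simp add: matrix_add_ldistrib[symmetric])
      also have "\<dots> = l (Y ** (X + - X')) + l (Y ** X')"
        using X that by (intro l_add order_mult order_add order_uminus)
      finally show ?thesis using eq[OF that] by simp
    qed
    then have "X + - X' = 0" using X by (intro nondeg order_add order_uminus)
    then show ?thesis by simp
  qed
  have "\<exists>X\<in>?R. \<forall>Y\<in>?R. l (Y ** X) = dot v (Y *v w)" for v w
    by (rule rep) (simp_all add: matrix_vector_mult_add_rdistrib dot_add dot_mat flip: matrix_vector_mul_assoc)
  then obtain \<Phi> where \<Phi>: "\<And>v w. \<Phi> v w \<in> ?R" and l\<Phi>: "\<And>v w Y. Y \<in> ?R \<Longrightarrow> l (Y ** \<Phi> v w) = dot v (Y *v w)"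
    by metis
  have mult_r: "\<Phi> v (X *v w) = X ** \<Phi> v w" if X: "X \<in> ?R" for v w X
    by (rule unique) (use \<Phi> X in \<open>simp_all add: order_mult l\<Phi> matrix_mul_assoc matrix_vector_mul_assoc\<close>)
  have mult_l: "\<Phi> (v v* X) w = X ** \<Phi> v w" if X: "X \<in> ?R" for v w X
  proof (rule unique)
    fix Y assume Y: "Y \<in> ?R"
    have "l (Y ** \<Phi> (v v* X) w) = dot v ((X ** Y) *v w)"
      using Y by (simp add: l\<Phi> dot_adjoint matrix_vector_mul_assoc)
    also have "\<dots> = l (Y ** (X ** \<Phi> v w))"
      using X Y by (simp add: order_commute[OF X Y] l\<Phi> order_mult matrix_mul_assoc)
    finally show "l (Y ** \<Phi> (v v* X) w) = l (Y ** (X ** \<Phi> v w))" .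
  qed (use \<Phi> X in \<open>auto intro: order_mult\<close>)
  show thesis
  proof (rule that[of \<Phi>])
    show "\<Phi> (v + v') w = \<Phi> v w + \<Phi> v' w" for v v' w
      by (rule unique) (use \<Phi> in \<open>simp_all add: order_add order_mult l\<Phi> l_add matrix_add_ldistrib dot_add\<close>)
    show "\<Phi> v (w + w') = \<Phi> v w + \<Phi> v w'" for v w w'
      by (rule unique) (use \<Phi> in \<open>simp_all add: order_add order_mult l\<Phi> l_add matrix_add_ldistrib dot_add matrix_vector_right_distrib\<close>)
    show "w = w'" if "\<And>i. \<Phi> (axis i 1) w = \<Phi> (axis i 1) w'" for w w'
      using that l\<Phi>[OF order_mat[of 1]] by (metis vec_eq_iff dot_axis matrix_vector_mul_lid)
    fix \<psi> :: "int ^ 'n \<Rightarrow> int ^ 'n ^ 'n"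
    assume \<psi>: "\<And>v. \<psi> v \<in> ?R" and \<psi>_add: "\<And>v v'. \<psi> (v + v') = \<psi> v + \<psi> v'"
      and \<psi>_A: "\<And>v. \<psi> (v v* A) = A ** \<psi> v"
    define w where "w = (\<chi> i. l (\<psi> (axis i 1)))"
    have l\<psi>: "l (\<psi> v) = dot v w" for v
    proof (induction v rule: int_vec_induct)
      case (1 i)
      then show ?case by (simp add: dot_axis w_def)
    next
      case (2 v v')
      have "l (\<psi> v) = l (\<psi> (v - v')) + l (\<psi> v')" "dot v w = dot (v - v') w + dot v' w"
        using \<psi>_add[of "v - v'" v'] dot_add(1)[of "v - v'" v' w] \<psi> by (simp_all add: l_add)
      then show ?case using 2 by simp
    qed
    have \<psi>_0: "\<psi> 0 = 0" using \<psi>_add[of 0 0] by simp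
    have \<psi>_mat: "\<psi> (v v* mat c) = mat c ** \<psi> v" for v c
    proof (induction c rule: int_induct[of _ 0])
      case base
      then show ?case by (simp add: \<psi>_0)
    next
      case (step1 c)
      then show ?case
        by (simp add: mat_add \<psi>_add mat_add_rdistrib vector_matrix_mult_add_rdistrib)
    next
      case (step2 c)
      have "mat c = mat (c - 1) + (mat 1 :: int ^ 'n ^ 'n)" by (simp flip: mat_add)
      then have "\<psi> (v v* mat (c - 1)) + \<psi> v = mat (c - 1) ** \<psi> v + \<psi> v"
        using step2(2) by (simp add: \<psi>_add mat_add_rdistrib vector_matrix_mult_add_rdistrib)
      then show ?case by simp
    qed
    have \<psi>_R: "\<psi> (v v* poly_mat A p) = poly_mat A p ** \<psi> v" for v p
    proof (induction p arbitrary: v)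
      case (pCons c p)
      then show ?case
        by (simp add: vector_matrix_mult_add_rdistrib \<psi>_add \<psi>_mat mat_add_rdistrib \<psi>_A
          flip: vector_matrix_mul_assoc) (metis order_commute order_self rangeI matrix_mul_assoc)
    qed (simp add: \<psi>_0)
    have "\<psi> v = \<Phi> v w" for v
    proof (rule unique)
      fix Y assume "Y \<in> ?R"
      then show "l (Y ** \<psi> v) = l (Y ** \<Phi> v w)"
        by (auto simp: l\<Phi> l\<psi> dot_adjoint simp flip: \<psi>_R)
    qed (fact \<psi> \<Phi>)+
    then show "\<exists>w. \<forall>v. \<psi> v = \<Phi> v w" by blast
  qed (fact \<Phi> mult_l mult_r)+
qed

section \<open>Inverting the matrix\<close>

text \<open>The stage \<open>N\<close> of a class counts negative powers of \<open>A\<close>: singly in \<open>K\<^sub>0(S)\<close> and \<open>K\<^sub>0(U)\<close>, but twice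
  in the limit of the commutant, whose connecting map multiplies by \<open>A\<close> on both sides.\<close>

lemma S_map_funpow: "(S_map A ^^ k) v = v v* mat_pow A k"
  by (induction k arbitrary: v)
    (simp_all add: funpow_Suc_right mat_pow_Suc vector_matrix_mul_assoc del: funpow.simps(2))

lemma U_map_funpow: "(U_map A ^^ k) w = mat_pow A k *v w"
  by (induction k) (simp_all add: mat_pow_Suc matrix_vector_mul_assoc)

lemma C_map_funpow: "X \<in> matrix_order A \<Longrightarrow> (C_map A ^^ k) X = mat_pow A (2 * k) ** X"
proof (induction k)
  case (Suc k)
  have "A ** (mat_pow A (2 * k) ** X) ** A = A ** (A ** (mat_pow A (2 * k) ** X))"
    using Suc.prems
    by (simp only: matrix_mul_assoc[symmetric]) (metis order_commute order_mult order_self rangeI matrix_mul_assoc)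
  with Suc show ?case by (simp add: mat_pow_Suc matrix_mul_assoc)
qed simp

lemma order_commutant: "X \<in> matrix_order A \<Longrightarrow> X \<in> commutant A"
  using order_subset_commutant by blast

lemma C_class_shift:
  "X \<in> matrix_order A \<Longrightarrow> C_class A (mat_pow A (2 * k) ** X) (N + k) = C_class A X N"
  using C.lim_class_funpow[OF order_commutant, of X A k N] by (simp add: C_map_funpow add.commute)

lemma S_class_shift: "S_class A (v v* mat_pow A k) (N + k) = S_class A v N"
  using S.lim_class_funpow[of v A k N] by (simp add: S_map_funpow add.commute)

lemma U_class_shift: "U_class A (mat_pow A k *v w) (N + k) = U_class A w N"
  using U.lim_class_funpow[of w A k N] by (simp add: U_map_funpow add.commute)

lemma K0_simps:
  "carrier (K0_S A) = lim_carrier (S_map A) UNIV" "carrier (K0_U A) = lim_carrier (U_map A) UNIV"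
  "add (K0_S A) = lim_add (S_map A) UNIV" "add (K0_U A) = lim_add (U_map A) UNIV"
  by (simp_all add: K0_S_def K0_U_def)

lemma S_class_carrier: "S_class A v N \<in> carrier (K0_S A)"
  by (simp add: K0_simps S.lim_class_closed)

lemma R_mult:
  "X \<in> matrix_order A \<Longrightarrow> Y \<in> matrix_order A \<Longrightarrow>
     C_class A X N \<otimes>\<^bsub>R_ring A\<^esub> C_class A Y M = C_class A (X ** Y) (N + M)"
  by (simp add: R_ring_ops K0_C_mult order_commutant)

lemma R_add:
  "X \<in> matrix_order A \<Longrightarrow> Y \<in> matrix_order A \<Longrightarrow>
     C_class A X N \<oplus>\<^bsub>R_ring A\<^esub> C_class A Y N = C_class A (X + Y) N"
  by (simp add: R_ring_ops C.lim_add_class_same order_commutant)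

text \<open>The set on the right is closed under the ring operations since two classes can be moved to a common stage.
  Conversely \<open>[X, N] = [X, 0] * [1, N]\<close>, where \<open>[X, 0]\<close> is a polynomial in \<open>[A, 0]\<close>, and \<open>[1, N]\<close> is a
  power of \<open>[1, 1] = [A, 1] * [A, 1]\<close>.\<close>

lemma R_ring_carrier: "carrier (R_ring A) = {C_class A X N | X N. X \<in> matrix_order A}"
proof (rule antisym; rule subsetI)
  interpret R: cring "R_ring A" by (rule R_ring_cring)
  let ?E = "{C_class A X N | X N. X \<in> matrix_order A}"
  note ops = K0_C_mult R_ring_ops order_commutant order_mult
  have genR: "C_class A A 0 \<in> carrier (R_ring A)" "C_class A A 1 \<in> carrier (R_ring A)"
    by (auto simp: R_ring_def intro: generate_ring.incl)
  have zero: "zero (R_ring A) = C_class A 0 0"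
    by (simp add: R_ring_def K0_C_def)
  have C_minus: "\<ominus>\<^bsub>K0_C A\<^esub> C_class A X N = C_class A (- X) N" if "X \<in> matrix_order A" for X N
  proof -
    interpret K: ring "K0_C A" by (rule K0_C_ring)
    show ?thesis
      using that order_uminus[OF that] C.lim_class_zero[of A N]
        C.lim_add_class_same[of "- X" A X N]
      by (intro K.minus_equality)
        (simp_all add: K0_C_def C.lim_class_closed order_commutant)
  qed
  have EI: "C_class A X N \<in> ?E" if "X \<in> matrix_order A" for X N
    using that by blast
  show "r \<in> ?E" if "r \<in> carrier (R_ring A)" for r
  proof -
    have "r \<in> generate_ring (K0_C A) {C_class A A 0, C_class A A 1}"
      using that by (simp add: R_ring_def)
    then show ?thesis
    proof (induction rule: generate_ring.induct)
      case one
      have "\<one>\<^bsub>K0_C A\<^esub> = C_class A (mat 1) 0" by (simp add: K0_C_def)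
      then show ?case by (simp only: EI[OF order_mat])
    next
      case (incl h)
      then consider "h = C_class A A 0" | "h = C_class A A 1" by blast
      then show ?case by cases (simp_all only: EI[OF order_self])
    next
      case (a_inv h)
      then obtain X N where *: "X \<in> matrix_order A" "h = C_class A X N" by blast
      then have "\<ominus>\<^bsub>K0_C A\<^esub> h = C_class A (- X) N" by (simp only: C_minus)
      then show ?case by (simp only: EI[OF order_uminus[OF *(1)]])
    next
      case (eng_add h k)
      then obtain X N Y M where *: "X \<in> matrix_order A" "Y \<in> matrix_order A"
        "h = C_class A X N" "k = C_class A Y M" by blast
      have "h \<oplus>\<^bsub>K0_C A\<^esub> k =
          C_class A (mat_pow A (2 * M) ** X + mat_pow A (2 * N) ** Y) (N + M)"
        using C.lim_add_class[of X A Y N M] *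
        by (simp add: K0_C_def order_commutant C_map_funpow)
      moreover have "mat_pow A (2 * M) ** X + mat_pow A (2 * N) ** Y \<in> matrix_order A"
        using * by (intro order_add order_mult rangeI)
      ultimately show ?case by (simp only: EI)
    next
      case (eng_mult h k)
      then obtain X N Y M where *: "X \<in> matrix_order A" "Y \<in> matrix_order A"
        "h = C_class A X N" "k = C_class A Y M" by blast
      then have "h \<otimes>\<^bsub>K0_C A\<^esub> k = C_class A (X ** Y) (N + M)" by (simp add: ops)
      then show ?case by (simp only: EI[OF order_mult[OF *(1,2)]])
    qed
  qed
  have const: "C_class A (mat c) 0 \<in> carrier (R_ring A)" for c
  proof (induction c rule: int_induct[of _ 0])
    case base
    then show ?case using R.zero_closed by (simp add: zero)
  next
    case (step1 c)
    then show ?case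
      using R.a_closed[OF step1(2) R.one_closed] by (simp add: R_add order_mat mat_add R_ring_ops(3))
  next
    case (step2 c)
    have "mat c + - mat 1 = (mat (c - 1) :: int ^ 'a ^ 'a)" by (simp add: vec_eq_iff mat_def)
    moreover have "C_class A (- mat 1) 0 \<in> carrier (R_ring A)"
    proof -
      have "C_class A (- mat 1) 0 = \<ominus>\<^bsub>K0_C A\<^esub> \<one>\<^bsub>K0_C A\<^esub>"
        using C_minus[OF order_mat, of 1 0] by (simp add: K0_C_def)
      then show ?thesis
        by (simp add: R_ring_def generate_ring.a_inv generate_ring.one)
    qed
    ultimately show ?case
      using R.a_closed[OF step2(2)] by (metis R_add order_mat order_uminus)
  qed
  have poly: "C_class A (poly_mat A p) 0 \<in> carrier (R_ring A)" for p
  proof (induction p)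
    case 0
    then show ?case using R.zero_closed by (simp add: zero)
  next
    case (pCons c p)
    have "C_class A (A ** poly_mat A p) 0 = C_class A A 0 \<otimes>\<^bsub>R_ring A\<^esub> C_class A (poly_mat A p) 0"
      by (simp add: R_mult order_self)
    then have "C_class A (A ** poly_mat A p) 0 \<in> carrier (R_ring A)"
      using genR(1) pCons.IH by simp
    then have "C_class A (mat c) 0 \<oplus>\<^bsub>R_ring A\<^esub> C_class A (A ** poly_mat A p) 0 \<in> carrier (R_ring A)"
      using const by simp
    then show ?case by (simp add: R_add order_mat order_mult order_self)
  qed
  have stage: "C_class A (mat 1) N \<in> carrier (R_ring A)" for N
  proof (induction N)
    case 0
    then show ?case using const by simp
  next
    case (Suc N)
    have "C_class A A 1 \<otimes>\<^bsub>R_ring A\<^esub> C_class A A 1 = C_class A (A ** A) (1 + 1)"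
      by (rule R_mult[OF order_self order_self])
    also have "\<dots> = C_class A (mat 1) 1"
      using C_class_shift[OF order_mat, of A 1 1 1] by (simp add: numeral_2_eq_2 mat_pow_Suc)
    finally have "C_class A (mat 1) 1 \<in> carrier (R_ring A)"
      using genR(2) by (metis R.m_closed)
    from R.m_closed[OF this Suc.IH] show ?case by (simp add: R_mult order_mat)
  qed
  show "r \<in> carrier (R_ring A)" if "r \<in> ?E" for r
  proof -
    from that obtain p N where "r = C_class A (poly_mat A p) N" by blast
    also have "\<dots> = C_class A (poly_mat A p) 0 \<otimes>\<^bsub>R_ring A\<^esub> C_class A (mat 1) N"
      by (simp add: R_mult order_mat)
    finally show ?thesis using poly stage by simp
  qed
qed

lemma R_mem: "X \<in> matrix_order A \<Longrightarrow> C_class A X N \<in> carrier (R_ring A)"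
  unfolding R_ring_carrier by blast

lemma R_cases:
  assumes "r \<in> carrier (R_ring A)"
  obtains X N where "X \<in> matrix_order A" "r = C_class A X N"
  using assms unfolding R_ring_carrier by auto

text \<open>Equality in the limit is equality up to a power of \<open>A\<close>, which need not be injective.\<close>

lemma C_class_eqD:
  assumes "X \<in> matrix_order A" "Y \<in> matrix_order A" "C_class A X N = C_class A Y N"
  obtains k where "mat_pow A k ** X = mat_pow A k ** Y"
  using assms by (auto simp: C.lim_class_eq_iff order_commutant C_map_funpow)

section \<open>The dual of K0(S)\<close>

lemma modules_isomorphic_inverse:
  assumes M: "module R M" and \<theta>: "\<theta> \<in> module_homs R M N" and bij: "bij_betw \<theta> (carrier M) (carrier N)"
  shows "modules_isomorphic R N M"
proof -
  interpret M: module R M by (rule M)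
  let ?\<eta> = "inv_into (carrier M) \<theta>"
  have \<eta>: "bij_betw ?\<eta> (carrier N) (carrier M)" by (rule bij_betw_inv_into[OF bij])
  have inv1: "?\<eta> (\<theta> x) = x" if "x \<in> carrier M" for x
    using bij that by (rule bij_betw_inv_into_left)
  have inv2: "\<theta> (?\<eta> y) = y" if "y \<in> carrier N" for y
    using bij that by (rule bij_betw_inv_into_right)
  have mem: "?\<eta> y \<in> carrier M" if "y \<in> carrier N" for y
    using \<eta> that by (rule bij_betw_apply)
  have "?\<eta> (s \<oplus>\<^bsub>N\<^esub> t) = ?\<eta> s \<oplus>\<^bsub>M\<^esub> ?\<eta> t" if "s \<in> carrier N" "t \<in> carrier N" for s t
  proof -
    have "s \<oplus>\<^bsub>N\<^esub> t = \<theta> (?\<eta> s \<oplus>\<^bsub>M\<^esub> ?\<eta> t)"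
      using \<theta> that mem by (simp add: module_homs_def inv2)
    then show ?thesis using that mem by (simp add: inv1)
  qed
  moreover have "?\<eta> (r \<odot>\<^bsub>N\<^esub> s) = r \<odot>\<^bsub>M\<^esub> ?\<eta> s" if "r \<in> carrier R" "s \<in> carrier N" for r s
  proof -
    have "r \<odot>\<^bsub>N\<^esub> s = \<theta> (r \<odot>\<^bsub>M\<^esub> ?\<eta> s)"
      using \<theta> that mem by (simp add: module_homs_def inv2)
    then show ?thesis using that mem by (simp add: inv1)
  qed
  ultimately have "?\<eta> \<in> module_homs R N M"
    using mem by (simp add: module_homs_def Pi_iff)
  with \<eta> show ?thesis by (auto simp: modules_isomorphic_def)
qed

abbreviation dual_module where
  "dual_module A \<equiv> Hom_module (R_ring A) (K0_S A) (regular_module (R_ring A))"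

lemma dual_module_carrier:
  "\<phi> \<in> carrier (dual_module A) \<longleftrightarrow> \<phi> \<in> extensional (carrier (K0_S A)) \<and>
    (\<forall>s\<in>carrier (K0_S A). \<phi> s \<in> carrier (R_ring A)) \<and>
    (\<forall>s\<in>carrier (K0_S A). \<forall>t\<in>carrier (K0_S A). \<phi> (s \<oplus>\<^bsub>K0_S A\<^esub> t) = \<phi> s \<oplus>\<^bsub>R_ring A\<^esub> \<phi> t) \<and>
    (\<forall>r\<in>carrier (R_ring A). \<forall>s\<in>carrier (K0_S A). \<phi> (r \<odot>\<^bsub>K0_S A\<^esub> s) = r \<otimes>\<^bsub>R_ring A\<^esub> \<phi> s)"
  by (auto simp: Hom_module_def module_homs_def regular_module_def)

lemma dual_moduleD:
  assumes "\<phi> \<in> carrier (dual_module A)" "s \<in> carrier (K0_S A)"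
  shows "\<phi> s \<in> carrier (R_ring A)"
    "t \<in> carrier (K0_S A) \<Longrightarrow> \<phi> (s \<oplus>\<^bsub>K0_S A\<^esub> t) = \<phi> s \<oplus>\<^bsub>R_ring A\<^esub> \<phi> t"
    "r \<in> carrier (R_ring A) \<Longrightarrow> \<phi> (r \<odot>\<^bsub>K0_S A\<^esub> s) = r \<otimes>\<^bsub>R_ring A\<^esub> \<phi> s"
  using assms unfolding dual_module_carrier by blast+

text \<open>\<open>[v, N] = A\<^sup>-\<^sup>N [v, 0]\<close>, with \<open>A\<^sup>-\<^sup>N\<close> represented in \<open>R\<^sub>A\<close> as \<open>[A\<^sup>N, N]\<close>.  Hence \<open>K\<^sub>0(S)\<close> is generated by the classes of
  stage 0.\<close>

lemma S_class_eq_smult: "C_class A (mat_pow A N) N \<odot>\<^bsub>K0_S A\<^esub> S_class A v 0 = S_class A v N"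
  using S_class_shift[of A v N N] by (simp add: K0_S_smult order_commutant mult_2)

lemma dual_module_eqI:
  assumes "\<phi> \<in> carrier (dual_module A)" "\<psi> \<in> carrier (dual_module A)"
    and eq: "\<And>v. \<phi> (S_class A v 0) = \<psi> (S_class A v 0)"
  shows "\<phi> = \<psi>"
proof (rule extensionalityI)
  show "\<phi> \<in> extensional (carrier (K0_S A))" "\<psi> \<in> extensional (carrier (K0_S A))"
    using assms by (simp_all add: dual_module_carrier)
  fix s assume "s \<in> carrier (K0_S A)"
  then obtain v N where "s = S_class A v N"
    by (auto simp: K0_simps elim: S.lim_carrier_cases)
  then have s: "s = C_class A (mat_pow A N) N \<odot>\<^bsub>K0_S A\<^esub> S_class A v 0"
    by (simp add: S_class_eq_smult)
  have "C_class A (mat_pow A N) N \<in> carrier (R_ring A)"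
    by (rule R_mem) simp
  then show "\<phi> s = \<psi> s"
    unfolding s using assms(1,2) by (simp only: dual_moduleD(3) S_class_carrier eq)
qed

text \<open>Every homomorphism from \<open>K\<^sub>0(S)\<close> to \<open>R\<^sub>A\<close> comes, up to a power of \<open>A\<close>, from a homomorphism of row
  vectors to \<open>\<int>[A]\<close>.  The values on the finitely many unit vectors have a common denominator \<open>A\<^sup>2\<^sup>N\<close>,
  which gives an additive lift \<open>\<xi>\<close>.  It commutes with \<open>A\<close> only in the limit; as this again concerns
  only finitely many vectors, multiplication by one power of \<open>A\<close> makes it commute on the nose.\<close>

lemma dual_module_lift:
  fixes A :: "int ^ 'n ^ 'n"
  assumes \<phi>: "\<phi> \<in> carrier (dual_module A)"
  obtains \<psi> N where "\<And>v. \<psi> v \<in> matrix_order A" "\<And>v v'. \<psi> (v + v') = \<psi> v + \<psi> v'"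
    "\<And>v. \<psi> (v v* A) = A ** \<psi> v" "\<And>v. \<phi> (S_class A v 0) = C_class A (\<psi> v) N"
proof -
  interpret R: cring "R_ring A" by (rule R_ring_cring)
  have \<phi>_R: "\<phi> (S_class A v 0) \<in> carrier (R_ring A)" for v
    using \<phi> by (simp only: dual_moduleD(1) S_class_carrier)
  have \<phi>_add: "\<phi> (S_class A (v + v') 0) = \<phi> (S_class A v 0) \<oplus>\<^bsub>R_ring A\<^esub> \<phi> (S_class A v' 0)" for v v'
  proof -
    have "S_class A (v + v') 0 = S_class A v 0 \<oplus>\<^bsub>K0_S A\<^esub> S_class A v' 0"
      by (simp add: K0_simps S.lim_add_class_same)
    then show ?thesis using \<phi> by (simp only: dual_moduleD(2) S_class_carrier)
  qed
  have \<phi>_A: "\<phi> (S_class A (v v* A) 0) = C_class A A 0 \<otimes>\<^bsub>R_ring A\<^esub> \<phi> (S_class A v 0)" for v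
  proof -
    have "C_class A A 0 \<odot>\<^bsub>K0_S A\<^esub> S_class A v 0 = S_class A (v v* A) 0"
      by (simp add: K0_S_smult self_mem_commutant)
    moreover have "C_class A A 0 \<in> carrier (R_ring A)"
      by (rule R_mem[OF order_self])
    ultimately show ?thesis using dual_moduleD(3)[OF \<phi> S_class_carrier] by metis
  qed
  have "\<exists>X N. X \<in> matrix_order A \<and> \<phi> (S_class A (axis i 1) 0) = C_class A X N" for i
    using \<phi>_R[of "axis i 1"] by (auto simp: R_ring_carrier)
  then obtain X n where X: "\<And>i. X i \<in> matrix_order A"
    and \<phi>X: "\<And>i. \<phi> (S_class A (axis i 1) 0) = C_class A (X i) (n i)" by metis
  define N where "N = (\<Sum>i\<in>UNIV. n i)"
  have nN: "n i \<le> N" for i unfolding N_def by (rule member_le_sum) auto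
  define Y where "Y i = mat_pow A (2 * (N - n i)) ** X i" for i
  have Y: "Y i \<in> matrix_order A" for i by (auto simp: Y_def intro: order_mult X)
  have \<phi>Y: "\<phi> (S_class A (axis i 1) 0) = C_class A (Y i) N" for i
    using C_class_shift[OF X[of i], where k = "N - n i" and N = "n i"] nN[of i] by (simp add: \<phi>X Y_def)
  define \<xi> where "\<xi> v = (\<Sum>i\<in>UNIV. mat (v $ i) ** Y i)" for v
  have sum_order: "(\<Sum>i\<in>S. mat (v $ i) ** Y i) \<in> matrix_order A" if "finite S" for S v
    using that order_mat[of 0 A] by induction (simp_all add: order_add order_mult order_mat Y)
  have \<xi>: "\<xi> v \<in> matrix_order A" for v unfolding \<xi>_def by (rule sum_order) simp
  have \<xi>_add: "\<xi> (v + v') = \<xi> v + \<xi> v'" for v v'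
    by (simp add: \<xi>_def mat_add mat_add_rdistrib sum.distrib)
  have \<phi>\<xi>: "\<phi> (S_class A v 0) = C_class A (\<xi> v) N" for v
  proof (induction v rule: int_vec_induct)
    case (1 i)
    have "\<xi> (axis i 1) = (\<Sum>j\<in>UNIV. if j = i then Y j else 0)"
      unfolding \<xi>_def by (intro sum.cong) (auto simp: axis_def)
    then show ?case by (simp add: \<phi>Y)
  next
    case (2 v v')
    have "\<phi> (S_class A (v - v') 0) \<oplus>\<^bsub>R_ring A\<^esub> \<phi> (S_class A v' 0) = C_class A (\<xi> (v - v') + \<xi> v') N"
      using \<phi>_add[of "v - v'" v'] \<xi>_add[of "v - v'" v'] 2 by simp
    also have "\<dots> = C_class A (\<xi> (v - v')) N \<oplus>\<^bsub>R_ring A\<^esub> \<phi> (S_class A v' 0)"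
      using 2 \<xi> by (simp add: R_add)
    finally show ?case
      by (rule R.add.right_cancel[THEN iffD1, rotated 3]) (intro \<phi>_R R_mem \<xi>)+
  qed
  have "\<exists>k. mat_pow A k ** \<xi> (axis i 1 v* A) = mat_pow A k ** (A ** \<xi> (axis i 1))" for i
  proof -
    have "C_class A (\<xi> (axis i 1 v* A)) N = C_class A (A ** \<xi> (axis i 1)) N"
      using \<phi>_A[of "axis i 1"] \<xi> by (simp add: \<phi>\<xi> R_mult order_self)
    then show ?thesis
      by (rule C_class_eqD[OF \<xi> order_mult[OF order_self \<xi>]]) blast
  qed
  then obtain k where k: "\<And>i. mat_pow A (k i) ** \<xi> (axis i 1 v* A) = mat_pow A (k i) ** (A ** \<xi> (axis i 1))"
    by metis
  define K where "K = (\<Sum>i\<in>UNIV. k i)"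
  have kK: "k i \<le> K" for i unfolding K_def by (rule member_le_sum) auto
  define \<psi> where "\<psi> v = mat_pow A (2 * K) ** \<xi> v" for v
  have \<psi>: "\<psi> v \<in> matrix_order A" for v by (simp add: \<psi>_def order_mult \<xi>)
  have \<psi>_add: "\<psi> (v + v') = \<psi> v + \<psi> v'" for v v'
    by (simp add: \<psi>_def \<xi>_add matrix_add_ldistrib)
  show thesis
  proof (rule that[OF \<psi> \<psi>_add])
    show "\<phi> (S_class A v 0) = C_class A (\<psi> v) (N + K)" for v
      unfolding \<psi>_def by (simp only: C_class_shift \<xi> \<phi>\<xi>)
    show "\<psi> (v v* A) = A ** \<psi> v" for v
    proof (induction v rule: int_vec_induct)
      case (1 i)
      have split: "mat_pow A (2 * K) = mat_pow A (2 * K - k i) ** mat_pow A (k i)"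
        using kK[of i] by (simp flip: mat_pow_add)
      have "\<psi> (axis i 1 v* A) = mat_pow A (2 * K) ** (A ** \<xi> (axis i 1))"
        unfolding \<psi>_def split by (simp only: matrix_mul_assoc[symmetric] k)
      also have "\<dots> = A ** \<psi> (axis i 1)"
        unfolding \<psi>_def matrix_mul_assoc
        by (simp only: order_commute[OF order_self rangeI])
      finally show ?case .
    next
      case (2 v v')
      have "\<psi> ((v - v') v* A) + \<psi> (v' v* A) = \<psi> (v v* A)"
        by (simp flip: \<psi>_add vector_matrix_left_distrib)
      moreover have "A ** \<psi> (v - v') + A ** \<psi> v' = A ** \<psi> v"
        by (simp flip: \<psi>_add matrix_add_ldistrib)
      ultimately show ?case using 2 by (metis add_right_cancel)
    qed
  qed
qed

text \<open>The duality of row and column vectors over \<open>\<int>[A]\<close>, as constructed in \<open>exists_dual_pairing\<close>; from here on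
  only these properties of \<open>\<Phi>\<close> matter.\<close>

locale dual_pairing =
  fixes A :: "int ^ 'n ^ 'n" and \<Phi> :: "int ^ 'n \<Rightarrow> int ^ 'n \<Rightarrow> int ^ 'n ^ 'n"
  assumes mem: "\<Phi> v w \<in> matrix_order A"
    and add_left: "\<Phi> (v + v') w = \<Phi> v w + \<Phi> v' w"
    and add_right: "\<Phi> v (w + w') = \<Phi> v w + \<Phi> v w'"
    and smult_left: "X \<in> matrix_order A \<Longrightarrow> \<Phi> (v v* X) w = X ** \<Phi> v w"
    and smult_right: "X \<in> matrix_order A \<Longrightarrow> \<Phi> v (X *v w) = X ** \<Phi> v w"
    and nondegenerate: "(\<And>i. \<Phi> (axis i 1) w = \<Phi> (axis i 1) w') \<Longrightarrow> w = w'"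
    and representing: "(\<And>v. \<psi> v \<in> matrix_order A) \<Longrightarrow> (\<And>v v'. \<psi> (v + v') = \<psi> v + \<psi> v') \<Longrightarrow>
       (\<And>v. \<psi> (v v* A) = A ** \<psi> v) \<Longrightarrow> \<exists>w. \<forall>v. \<psi> v = \<Phi> v w"
begin

text \<open>The map \<open>[v, N] \<mapsto> A\<^sup>-\<^sup>(\<^sup>N\<^sup>+\<^sup>M\<^sup>) \<Phi> v w\<close> for \<open>u = [w, M]\<close>.  Stage \<open>N + M\<close> of the ring carries the factor
  \<open>A\<^sup>-\<^sup>2\<^sup>(\<^sup>N\<^sup>+\<^sup>M\<^sup>)\<close>, which is why the representative is multiplied by \<open>A\<^sup>N\<^sup>+\<^sup>M\<close>.  The unions run over
  representatives; all the sets in them are equal by \<open>to_dual_class\<close>.\<close>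

definition to_dual where
  "to_dual u = (\<lambda>s\<in>carrier (K0_S A).
     \<Union>(v, N)\<in>s. \<Union>(w, M)\<in>u. C_class A (mat_pow A (N + M) ** \<Phi> v w) (N + M))"

lemma to_dual_class:
  "to_dual (U_class A w M) (S_class A v N) = C_class A (mat_pow A (N + M) ** \<Phi> v w) (N + M)"
proof -
  have next_stage: "C_class A (mat_pow A (Suc n) ** (A ** X)) (Suc n) = C_class A (mat_pow A n ** X) n"
    if "X \<in> matrix_order A" for X n
  proof -
    have "mat_pow A (Suc n) ** (A ** X) = mat_pow A (2 * 1) ** (mat_pow A n ** X)"
    proof -
      have "mat_pow A (Suc n) ** (A ** X) = (mat_pow A (Suc n) ** mat_pow A 1) ** X"
        by (simp add: mat_pow_Suc matrix_mul_assoc)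
      also have "\<dots> = (mat_pow A (2 * 1) ** mat_pow A n) ** X"
        by (simp only: mat_pow_add[symmetric]) simp
      finally show ?thesis by (simp only: matrix_mul_assoc)
    qed
    then show ?thesis using C_class_shift[of "mat_pow A n ** X" A 1 n] that
      by (simp add: order_mult)
  qed
  have "(\<Union>(w, M)\<in>U_class A w M. C_class A (mat_pow A (N + M) ** \<Phi> v w) (N + M)) =
      C_class A (mat_pow A (N + M) ** \<Phi> v w) (N + M)" for v N
    by (rule U.UN_lim_class) (simp_all only: smult_right order_self add_Suc_right next_stage mem UNIV_I)
  moreover have "(\<Union>(v, N)\<in>S_class A v N. C_class A (mat_pow A (N + M) ** \<Phi> v w) (N + M)) =
      C_class A (mat_pow A (N + M) ** \<Phi> v w) (N + M)"
    by (rule S.UN_lim_class) (simp_all only: smult_left order_self add_Suc next_stage mem UNIV_I)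
  ultimately show ?thesis by (simp add: to_dual_def S_class_carrier)
qed

lemma to_dual_dual_module:
  assumes "u \<in> carrier (K0_U A)"
  shows "to_dual u \<in> carrier (dual_module A)"
proof -
  obtain w M where u: "u = U_class A w M"
    using assms by (auto simp: K0_simps elim: U.lim_carrier_cases)
  have ext: "to_dual u \<in> extensional (carrier (K0_S A))" by (simp add: to_dual_def)
  have closed: "to_dual u s \<in> carrier (R_ring A)" if s: "s \<in> carrier (K0_S A)" for s
  proof -
    obtain v N where "s = S_class A v N"
      using s by (auto simp: K0_simps elim: S.lim_carrier_cases)
    then show ?thesis
      by (simp only: u to_dual_class) (intro R_mem order_mult rangeI mem)
  qed
  have add: "to_dual u (s \<oplus>\<^bsub>K0_S A\<^esub> t) = to_dual u s \<oplus>\<^bsub>R_ring A\<^esub> to_dual u t"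
    if *: "s \<in> carrier (K0_S A)" "t \<in> carrier (K0_S A)" for s t
  proof -
    obtain v v' N where st: "s = S_class A v N" "t = S_class A v' N"
      using * unfolding K0_simps by (metis S.lim_carrier_cases2)
    have "s \<oplus>\<^bsub>K0_S A\<^esub> t = S_class A (v + v') N"
      by (simp add: st K0_simps S.lim_add_class_same)
    then show ?thesis
      by (simp add: u st to_dual_class R_add order_mult mem add_left matrix_add_ldistrib)
  qed
  have smult: "to_dual u (r \<odot>\<^bsub>K0_S A\<^esub> s) = r \<otimes>\<^bsub>R_ring A\<^esub> to_dual u s"
    if *: "r \<in> carrier (R_ring A)" "s \<in> carrier (K0_S A)" for r s
  proof -
    obtain X L where X: "X \<in> matrix_order A" and r: "r = C_class A X L"
      using *(1) by (rule R_cases)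
    obtain v N where sv: "s = S_class A v N"
      using *(2) by (auto simp: K0_simps elim: S.lim_carrier_cases)
    have split: "mat_pow A (N + 2 * L + M) = mat_pow A (2 * L) ** mat_pow A (N + M)"
      by (simp only: mat_pow_add[symmetric]) (simp add: ac_simps)
    have "X ** mat_pow A (N + M) = mat_pow A (N + M) ** X"
      using X by (rule order_commute) simp
    then have "X ** (mat_pow A (N + M) ** \<Phi> v w) = mat_pow A (N + M) ** (X ** \<Phi> v w)"
      by (simp only: matrix_mul_assoc)
    then have shift: "mat_pow A (N + 2 * L + M) ** (X ** \<Phi> v w) =
        mat_pow A (2 * L) ** (X ** (mat_pow A (N + M) ** \<Phi> v w))"
      unfolding split by (simp only: matrix_mul_assoc)
    have stage: "N + 2 * L + M = (L + (N + M)) + L" by simp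
    have "r \<odot>\<^bsub>K0_S A\<^esub> s = S_class A (v v* X) (N + 2 * L)"
      unfolding r sv using X by (simp add: K0_S_smult order_commutant)
    then have "to_dual u (r \<odot>\<^bsub>K0_S A\<^esub> s) =
        C_class A (mat_pow A (N + 2 * L + M) ** (X ** \<Phi> v w)) (N + 2 * L + M)"
      using X by (simp add: u to_dual_class smult_left)
    also have "\<dots> = C_class A (X ** (mat_pow A (N + M) ** \<Phi> v w)) (L + (N + M))"
      unfolding shift unfolding stage by (rule C_class_shift) (intro order_mult X rangeI mem)
    also have "\<dots> = r \<otimes>\<^bsub>R_ring A\<^esub> to_dual u s"
      using X by (simp add: r u sv to_dual_class R_mult order_mult mem)
    finally show ?thesis .
  qed
  show ?thesis
    unfolding dual_module_carrier by (intro conjI ballI ext closed add smult)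
qed

lemma to_dual_add:
  assumes "u \<in> carrier (K0_U A)" "u' \<in> carrier (K0_U A)" "s \<in> carrier (K0_S A)"
  shows "to_dual (u \<oplus>\<^bsub>K0_U A\<^esub> u') s = to_dual u s \<oplus>\<^bsub>R_ring A\<^esub> to_dual u' s"
proof -
  obtain w w' M where u: "u = U_class A w M" "u' = U_class A w' M"
    using assms(1,2) unfolding K0_simps by (metis U.lim_carrier_cases2)
  obtain v N where s: "s = S_class A v N"
    using assms(3) by (auto simp: K0_simps elim: S.lim_carrier_cases)
  have "u \<oplus>\<^bsub>K0_U A\<^esub> u' = U_class A (w + w') M"
    by (simp add: u K0_simps U.lim_add_class_same)
  then show ?thesis
    by (simp add: u s to_dual_class R_add order_mult mem add_right matrix_add_ldistrib)
qed

text \<open>By the symmetry of \<open>\<Phi>\<close> under \<open>\<int>[A]\<close>, a scalar can be moved from \<open>u\<close> to the argument \<open>s\<close>.\<close>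

lemma to_dual_smult:
  assumes "r \<in> carrier (R_ring A)" "u \<in> carrier (K0_U A)" "s \<in> carrier (K0_S A)"
  shows "to_dual (r \<odot>\<^bsub>K0_U A\<^esub> u) s = r \<otimes>\<^bsub>R_ring A\<^esub> to_dual u s"
proof -
  obtain X L where X: "X \<in> matrix_order A" and r: "r = C_class A X L"
    using assms(1) by (rule R_cases)
  obtain w M where u: "u = U_class A w M"
    using assms(2) by (auto simp: K0_simps elim: U.lim_carrier_cases)
  obtain v N where s: "s = S_class A v N"
    using assms(3) by (auto simp: K0_simps elim: S.lim_carrier_cases)
  have "to_dual (r \<odot>\<^bsub>K0_U A\<^esub> u) s = to_dual u (r \<odot>\<^bsub>K0_S A\<^esub> s)"
    using X by (simp add: r u s K0_U_smult K0_S_smult order_commutant to_dual_class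
      smult_left smult_right add.commute add.left_commute)
  then show ?thesis
    using dual_moduleD(3)[OF to_dual_dual_module[OF assms(2)] assms(3,1)] by simp
qed

text \<open>Equality of the two homomorphisms on the unit vectors gives equality of the values of \<open>\<Phi>\<close> up to
  powers of \<open>A\<close>.  Finitely many vectors need only one power \<open>A\<^sup>K\<close>, and nondegeneracy yields
  \<open>A\<^sup>K w = A\<^sup>K w'\<close>.\<close>

lemma to_dual_inj: "inj_on to_dual (carrier (K0_U A))"
proof (rule inj_onI)
  fix u u' assume *: "u \<in> carrier (K0_U A)" "u' \<in> carrier (K0_U A)" "to_dual u = to_dual u'"
  then obtain w w' M where u: "u = U_class A w M" "u' = U_class A w' M"
    unfolding K0_simps by (metis U.lim_carrier_cases2)
  have "\<exists>k. mat_pow A k ** \<Phi> (axis i 1) w = mat_pow A k ** \<Phi> (axis i 1) w'" for i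
  proof -
    have "C_class A (mat_pow A M ** \<Phi> (axis i 1) w) M = C_class A (mat_pow A M ** \<Phi> (axis i 1) w') M"
      using fun_cong[OF *(3), of "S_class A (axis i 1) 0"] by (simp add: u to_dual_class)
    then obtain k where
      "mat_pow A k ** (mat_pow A M ** \<Phi> (axis i 1) w) = mat_pow A k ** (mat_pow A M ** \<Phi> (axis i 1) w')"
      by (rule C_class_eqD[OF order_mult[OF rangeI mem] order_mult[OF rangeI mem]])
    then show ?thesis by (metis matrix_mul_assoc mat_pow_add)
  qed
  then obtain k where k: "\<And>i. mat_pow A (k i) ** \<Phi> (axis i 1) w = mat_pow A (k i) ** \<Phi> (axis i 1) w'"
    by metis
  define K where "K = (\<Sum>i\<in>UNIV. k i)"
  have "mat_pow A K *v w = mat_pow A K *v w'"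
  proof (rule nondegenerate)
    fix i
    have "k i \<le> K" unfolding K_def by (rule member_le_sum) auto
    then have split: "mat_pow A K = mat_pow A (K - k i) ** mat_pow A (k i)"
      by (simp flip: mat_pow_add)
    have "mat_pow A K ** \<Phi> (axis i 1) w = mat_pow A K ** \<Phi> (axis i 1) w'"
      by (simp only: split matrix_mul_assoc[symmetric] k)
    then show "\<Phi> (axis i 1) (mat_pow A K *v w) = \<Phi> (axis i 1) (mat_pow A K *v w')"
      by (simp only: smult_right rangeI)
  qed
  then show "u = u'" unfolding u by (metis U_class_shift)
qed

lemma to_dual_surj:
  assumes \<phi>: "\<phi> \<in> carrier (dual_module A)"
  shows "\<phi> \<in> to_dual ` carrier (K0_U A)"
proof -
  obtain \<psi> N where "\<And>v. \<psi> v \<in> matrix_order A" "\<And>v v'. \<psi> (v + v') = \<psi> v + \<psi> v'"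
    "\<And>v. \<psi> (v v* A) = A ** \<psi> v" and \<phi>\<psi>: "\<And>v. \<phi> (S_class A v 0) = C_class A (\<psi> v) N"
    using \<phi> by (rule dual_module_lift) blast
  then obtain w where w: "\<And>v. \<psi> v = \<Phi> v w" using representing[of \<psi>] by blast
  \<comment> \<open>Stage \<open>N\<close> of the ring is \<open>A\<^sup>-\<^sup>2\<^sup>N\<close>, which is stage \<open>2 * N\<close> of the module.\<close>
  let ?u = "U_class A w (2 * N)"
  have u: "?u \<in> carrier (K0_U A)" by (simp add: K0_simps U.lim_class_closed)
  have "\<phi> (S_class A v 0) = to_dual ?u (S_class A v 0)" for v
    using C_class_shift[OF mem[of v w], where k = N and N = N] by (simp add: to_dual_class \<phi>\<psi> w mult_2)
  then have "\<phi> = to_dual ?u"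
    by (rule dual_module_eqI[OF \<phi> to_dual_dual_module[OF u]])
  with u show ?thesis by blast
qed

lemma dual_isomorphic: "modules_isomorphic (R_ring A) (dual_module A) (K0_U A)"
proof (rule modules_isomorphic_inverse[OF K0_U_module])
  show "bij_betw to_dual (carrier (K0_U A)) (carrier (dual_module A))"
    using to_dual_inj to_dual_dual_module to_dual_surj by (auto simp: bij_betw_def)
  interpret U: module "R_ring A" "K0_U A" by (rule K0_U_module)
  have ext: "to_dual u = restrict (to_dual u) (carrier (K0_S A))" for u
    by (simp add: to_dual_def)
  show "to_dual \<in> module_homs (R_ring A) (K0_U A) (dual_module A)"
    unfolding module_homs_def
  proof (intro CollectI conjI ballI)
    show "to_dual \<in> carrier (K0_U A) \<rightarrow> carrier (dual_module A)" using to_dual_dual_module by blast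
    show "to_dual (s \<oplus>\<^bsub>K0_U A\<^esub> t) = to_dual s \<oplus>\<^bsub>dual_module A\<^esub> to_dual t"
      if "s \<in> carrier (K0_U A)" "t \<in> carrier (K0_U A)" for s t
      by (subst ext) (use that in \<open>simp add: Hom_module_def regular_module_def to_dual_add cong: restrict_cong\<close>)
    show "to_dual (r \<odot>\<^bsub>K0_U A\<^esub> s) = r \<odot>\<^bsub>dual_module A\<^esub> to_dual s"
      if "r \<in> carrier (R_ring A)" "s \<in> carrier (K0_U A)" for r s
      by (subst ext) (use that in \<open>simp add: Hom_module_def regular_module_def to_dual_smult cong: restrict_cong\<close>)
  qed
qed

end

theorem theorem1p11:
  fixes A :: "int ^ 'n ^ 'n" and P :: "(int \<Rightarrow> 'n \<times> 'n \<times> nat) set"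
  assumes "primitive_matrix A"
    and "P \<subseteq> edge_shift A" and "finite P" and "P \<noteq> {}" and "shift_map ` P = P"
  shows "modules_isomorphic (R_ring A)
           (Hom_module (R_ring A) (K0_S A) (regular_module (R_ring A)))
           (K0_U A)"
proof -
  obtain \<Phi> where "dual_pairing A \<Phi>"
    by (rule exists_dual_pairing[of A]) (unfold dual_pairing_def, blast)
  then show ?thesis by (rule dual_pairing.dual_isomorphic)
qed

end
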